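(* Let $\mathbf{V}=\{V^n\}_{n=1}^\infty$ and $\mathbf{W}=\{W^n\}_{n=1}^\infty$ be a general source and a general channel, respectively. Suppose there exist some channel input $\mathbf{X}=\{X^n\}_{n=1}^\infty$, which may be arbitrarily correlated to the output of the source $\mathbf{V}$, and some sequence $\{\gamma_n\}_{n=1}^\infty$ of real numbers with $$\gamma_n>0,\quad \gamma_n\to0\quad\text{and}\quad n\gamma_n\to\infty\qquad(n\to\infty)$$ for which $$\lim_{n\to\infty}\Pr\left\{\frac1n\log\frac{W^n(Y^n|X^n)}{P_{Y^n}(Y^n)}\le\frac1n\log\frac1{P_{V^n}(V^n)}+\gamma_n\right\}=0,$$ where $Y^n$ is the channel output via $W^n$ due to the channel input $X^n$. Then the source $\mathbf{V}$ is transmissible over the channel $\mathbf{W}$.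
   Context: A general source $\mathbf{V}=\{V^n\}_{n=1}^\infty$ is an arbitrary sequence of random variables $V^n=(V_1^{(n)},\dots,V_n^{(n)})$ with values in $\mathcal{V}^n$, where the source alphabet $\mathcal{V}$ is a countably infinite set; no consistency between different $n$ is required. A general channel $\mathbf{W}=\{W^n(\cdot|\cdot):\mathcal{X}^n\to\mathcal{Y}^n\}_{n=1}^\infty$ is an arbitrary sequence of transition probabilities (Markov kernels) $W^n$ from $\mathcal{X}^n$ to $\mathcal{Y}^n$, where $\mathcal{X},\mathcal{Y}$ are arbitrary abstract (measurable) alphabets. $P_Z$ denotes the distribution of $Z$. Logarithms are natural. A channel input $\mathbf{X}=\{X^n\}$ is a sequence of random variables $X^n$ with values in $\mathcal{X}^n$. "$Y^n$ is the channel output via $W^n$ due to the input $X^n$" means that the conditional distribution of $Y^n$ given $X^n=\mathbf{x}$ is $W^n(\cdot|\mathbf{x})$ and $V^n\to X^n\to Y^n$ is a Markov chain. For abstract alphabets, $\frac{W^n(Y^n|X^n)}{P_{Y^n}(Y^n)}$ means $g(Y^n|X^n)$, where $g(\mathbf{y}|\mathbf{x})=\frac{W^n(d\mathbf{y}|\mathbf{x})}{P_{Y^n}(d\mathbf{y})}=\frac{P_{X^nY^n}(d\mathbf{x},d\mathbf{y})}{P_{X^n}(d\mathbf{x})P_{Y^n}(d\mathbf{y})}$ is the Radon-Nikodym derivative, measurable in $(\mathbf{x},\mathbf{y})$. A joint source-channel $(n,\varepsilon_n)$ code is a pair of an encoder $\varphi_n:\mathcal{V}^n\to\mathcal{X}^n$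 and a decoder $\psi_n:\mathcal{Y}^n\to\mathcal{V}^n$ (deterministic maps) whose probability of decoding error is $\varepsilon_n=\sum_{\mathbf{v}\in\mathcal{V}^n}P_{V^n}(\mathbf{v})\,W^n(\mathcal{D}^c(\mathbf{v})|\varphi_n(\mathbf{v}))$, where $\mathcal{D}(\mathbf{v})=\{\mathbf{y}\in\mathcal{Y}^n:\psi_n(\mathbf{y})=\mathbf{v}\}$. The source $\mathbf{V}$ is transmissible over the channel $\mathbf{W}$ if there exists a sequence of $(n,\varepsilon_n)$ codes with $\lim_{n\to\infty}\varepsilon_n=0$. *)

theory Defs
  imports "HOL-Probability.Probability"
begin

text \<open>
  Blocks of length \<open>n\<close> are extensional functions on \<open>{..<n}\<close>. Source blocks carry the discrete
  sigma-algebra, channel input and output blocks the product sigma-algebra of a measurable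
  alphabet; an alphabet given as a measure contributes only its space and its measurable sets.
  All sequences are indexed by \<open>n \<ge> 1\<close>; the entry at \<open>0\<close> is irrelevant.
\<close>

abbreviation source_blocks :: "'v set \<Rightarrow> nat \<Rightarrow> (nat \<Rightarrow> 'v) set" where
  "source_blocks A n \<equiv> {..<n} \<rightarrow>\<^sub>E A"

abbreviation source_space :: "'v set \<Rightarrow> nat \<Rightarrow> (nat \<Rightarrow> 'v) measure" where
  "source_space A n \<equiv> count_space (source_blocks A n)"

abbreviation block_space :: "'x measure \<Rightarrow> nat \<Rightarrow> (nat \<Rightarrow> 'x) measure" where
  "block_space MX n \<equiv> (\<Pi>\<^sub>M i\<in>{..<n}. MX)"

definition general_source ::
  "'v set \<Rightarrow> (nat \<Rightarrow> 'w measure) \<Rightarrow> (nat \<Rightarrow> 'w \<Rightarrow> nat \<Rightarrow> 'v) \<Rightarrow> bool" where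
  "general_source A \<Omega> V \<longleftrightarrow> countable A \<and> infinite A \<and>
     (\<forall>n\<ge>1. prob_space (\<Omega> n) \<and> V n \<in> \<Omega> n \<rightarrow>\<^sub>M source_space A n)"

definition source_law ::
  "'v set \<Rightarrow> (nat \<Rightarrow> 'w measure) \<Rightarrow> (nat \<Rightarrow> 'w \<Rightarrow> nat \<Rightarrow> 'v) \<Rightarrow> nat \<Rightarrow> (nat \<Rightarrow> 'v) measure" where
  "source_law A \<Omega> V n = distr (\<Omega> n) (source_space A n) (V n)"

definition general_channel ::
  "'x measure \<Rightarrow> 'y measure \<Rightarrow> (nat \<Rightarrow> (nat \<Rightarrow> 'x) \<Rightarrow> (nat \<Rightarrow> 'y) measure) \<Rightarrow> bool" where
  "general_channel MX MY W \<longleftrightarrow>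
     (\<forall>n\<ge>1. W n \<in> block_space MX n \<rightarrow>\<^sub>M prob_algebra (block_space MY n))"

definition channel_input ::
  "(nat \<Rightarrow> 'w measure) \<Rightarrow> 'x measure \<Rightarrow> (nat \<Rightarrow> 'w \<Rightarrow> nat \<Rightarrow> 'x) \<Rightarrow> bool" where
  "channel_input \<Omega> MX X \<longleftrightarrow> (\<forall>n\<ge>1. X n \<in> \<Omega> n \<rightarrow>\<^sub>M block_space MX n)"

definition has_conditional_law ::
  "'w measure \<Rightarrow> 'a measure \<Rightarrow> 'b measure \<Rightarrow> ('w \<Rightarrow> 'a) \<Rightarrow> ('w \<Rightarrow> 'b) \<Rightarrow> ('a \<Rightarrow> 'b measure) \<Rightarrow> bool" where
  "has_conditional_law M S T X Y K \<longleftrightarrow>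
     (\<forall>B\<in>sets S. \<forall>C\<in>sets T.
        emeasure M {\<omega> \<in> space M. X \<omega> \<in> B \<and> Y \<omega> \<in> C} =
        (\<integral>\<^sup>+ \<omega>. emeasure (K (X \<omega>)) C * indicator B (X \<omega>) \<partial>M))"

text \<open>The Markov chain \<open>V \<rightarrow> X \<rightarrow> Y\<close>: almost surely \<open>P(Y \<in> C | V, X) = P(Y \<in> C | X)\<close>.\<close>

definition markov_chain ::
  "'w measure \<Rightarrow> 'u measure \<Rightarrow> 'a measure \<Rightarrow> 'b measure \<Rightarrow>
   ('w \<Rightarrow> 'u) \<Rightarrow> ('w \<Rightarrow> 'a) \<Rightarrow> ('w \<Rightarrow> 'b) \<Rightarrow> bool" where
  "markov_chain M R S T V X Y \<longleftrightarrow>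
     (\<forall>C\<in>sets T. AE \<omega> in M.
        real_cond_exp M (vimage_algebra (space M) (\<lambda>\<omega>. (V \<omega>, X \<omega>)) (R \<Otimes>\<^sub>M S))
          (\<lambda>\<omega>. indicator C (Y \<omega>)) \<omega> =
        real_cond_exp M (vimage_algebra (space M) X S)
          (\<lambda>\<omega>. indicator C (Y \<omega>)) \<omega>)"

definition channel_output ::
  "'v set \<Rightarrow> 'x measure \<Rightarrow> 'y measure \<Rightarrow> (nat \<Rightarrow> 'w measure) \<Rightarrow>
   (nat \<Rightarrow> (nat \<Rightarrow> 'x) \<Rightarrow> (nat \<Rightarrow> 'y) measure) \<Rightarrow>
   (nat \<Rightarrow> 'w \<Rightarrow> nat \<Rightarrow> 'v) \<Rightarrow> (nat \<Rightarrow> 'w \<Rightarrow> nat \<Rightarrow> 'x) \<Rightarrow> (nat \<Rightarrow> 'w \<Rightarrow> nat \<Rightarrow> 'y) \<Rightarrow> bool" where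
  "channel_output A MX MY \<Omega> W V X Y \<longleftrightarrow>
     (\<forall>n\<ge>1. Y n \<in> \<Omega> n \<rightarrow>\<^sub>M block_space MY n \<and>
        has_conditional_law (\<Omega> n) (block_space MX n) (block_space MY n) (X n) (Y n) (W n) \<and>
        markov_chain (\<Omega> n) (source_space A n) (block_space MX n) (block_space MY n)
          (V n) (X n) (Y n))"

text \<open>
  \<open>g\<close> is a version of the Radon-Nikodym derivative of the joint law of \<open>X\<close> and \<open>Y\<close> with respect
  to the product of their laws, which is the meaning of the ratio \<open>W(y|x) / P_Y(y)\<close> on abstract
  alphabets. The derivative is finite almost everywhere, so a real-valued version loses nothing;
  it vanishes at \<open>(X, Y)\<close> only on a null event, where the logarithm of \<open>0\<close> does not matter.
\<close>

definition is_channel_ratio ::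
  "'w measure \<Rightarrow> 'a measure \<Rightarrow> 'b measure \<Rightarrow> ('w \<Rightarrow> 'a) \<Rightarrow> ('w \<Rightarrow> 'b) \<Rightarrow> ('a \<times> 'b \<Rightarrow> real) \<Rightarrow> bool" where
  "is_channel_ratio M S T X Y g \<longleftrightarrow>
     g \<in> borel_measurable (S \<Otimes>\<^sub>M T) \<and> (\<forall>z \<in> space (S \<Otimes>\<^sub>M T). 0 \<le> g z) \<and>
     distr M (S \<Otimes>\<^sub>M T) (\<lambda>\<omega>. (X \<omega>, Y \<omega>)) =
       density (distr M S X \<Otimes>\<^sub>M distr M T Y) (\<lambda>z. ennreal (g z))"

text \<open>The decoder is measurable, so that the error probabilities are defined.\<close>

definition is_code ::
  "'v set \<Rightarrow> 'x measure \<Rightarrow> 'y measure \<Rightarrow> nat \<Rightarrow>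
   ((nat \<Rightarrow> 'v) \<Rightarrow> (nat \<Rightarrow> 'x)) \<Rightarrow> ((nat \<Rightarrow> 'y) \<Rightarrow> (nat \<Rightarrow> 'v)) \<Rightarrow> bool" where
  "is_code A MX MY n \<phi> \<psi> \<longleftrightarrow>
     \<phi> \<in> source_blocks A n \<rightarrow> space (block_space MX n) \<and>
     \<psi> \<in> block_space MY n \<rightarrow>\<^sub>M source_space A n"

definition error_prob ::
  "'v set \<Rightarrow> 'y measure \<Rightarrow> nat \<Rightarrow> (nat \<Rightarrow> 'v) measure \<Rightarrow> ((nat \<Rightarrow> 'x) \<Rightarrow> (nat \<Rightarrow> 'y) measure) \<Rightarrow>
   ((nat \<Rightarrow> 'v) \<Rightarrow> (nat \<Rightarrow> 'x)) \<Rightarrow> ((nat \<Rightarrow> 'y) \<Rightarrow> (nat \<Rightarrow> 'v)) \<Rightarrow> real" where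
  "error_prob A MY n P K \<phi> \<psi> =
     (\<Sum>\<^sub>\<infinity>v\<in>source_blocks A n.
        measure P {v} * measure (K (\<phi> v)) {y \<in> space (block_space MY n). \<psi> y \<noteq> v})"

definition transmissible ::
  "'v set \<Rightarrow> 'x measure \<Rightarrow> 'y measure \<Rightarrow> (nat \<Rightarrow> (nat \<Rightarrow> 'v) measure) \<Rightarrow>
   (nat \<Rightarrow> (nat \<Rightarrow> 'x) \<Rightarrow> (nat \<Rightarrow> 'y) measure) \<Rightarrow> bool" where
  "transmissible A MX MY P W \<longleftrightarrow>
     (\<exists>\<phi> \<psi>. (\<forall>n\<ge>1. is_code A MX MY n (\<phi> n) (\<psi> n)) \<and>
        (\<lambda>n. error_prob A MY n (P n) (W n) (\<phi> n) (\<psi> n)) \<longlonglongrightarrow> 0)"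

end

theory Submission imports Defs begin

text \<open>
  The proof is by random coding with a threshold decoder. Fix a block length and write \<open>p\<close> for the
  source probabilities, \<open>g\<close> for the channel ratio and \<open>a = exp (n \<gamma>)\<close>. For every source block \<open>v\<close> draw a
  codeword independently from the conditional law of \<open>X\<close> given \<open>V = v\<close>; this is how a correlation
  between the channel input and the source is exploited. A block \<open>v\<close> with codeword \<open>x\<close> accepts the
  output \<open>y\<close> when \<open>g(x, y) > a / p(v)\<close>, and the decoder returns the block that accepts if exactly one
  does.

  Two events cause an error. Firstly, the transmitted block may reject. By the Markov property the
  transmitted block, its random codeword and the output are distributed as \<open>(V, X, Y)\<close>, so this has
  probability \<open>P(g(X, Y) p(V) \<le> a)\<close> on average (\<open>expected_rejection\<close>), which is the probability that
  tends to zero by hypothesis. Secondly, another block \<open>v'\<close> may accept. Its codeword \<open>x'\<close> is independent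
  of the output, and \<open>g(x', \<cdot>)\<close> has integral one under the output law, so by Markov's inequality this has
  probability at most \<open>p(v') / a\<close>. The sum over all \<open>v'\<close> is at most \<open>1 / a = exp (- n \<gamma>)\<close>
  (\<open>expected_confusion\<close>), which tends to zero because \<open>n \<gamma>\<close> tends to infinity.

  Some codebook does at least as well as the average (\<open>exists_code\<close>), and this codebook is a
  deterministic code. The random codebook is a point of the product of the codeword laws
  over the countable set of source blocks.
\<close>

section \<open>The joint law of a Markov chain\<close>

text \<open>
  The conditional law of \<open>Y\<close> given \<open>X\<close> identifies \<open>P(Y \<in> C | X)\<close> as \<open>K(X)(C)\<close>. The Markov property
  says that this is also \<open>P(Y \<in> C | V, X)\<close>, and integrating it over the event \<open>V \<in> U, X \<in> B\<close>, which
  is determined by \<open>(V, X)\<close>, gives the formula.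
\<close>

lemma markov_joint_law_rectangle:
  fixes V :: "'w \<Rightarrow> 'u" and X :: "'w \<Rightarrow> 'a" and Y :: "'w \<Rightarrow> 'b"
  assumes "prob_space M"
    and V[measurable]: "V \<in> M \<rightarrow>\<^sub>M R" and X[measurable]: "X \<in> M \<rightarrow>\<^sub>M S"
    and Y[measurable]: "Y \<in> M \<rightarrow>\<^sub>M T" and K: "K \<in> S \<rightarrow>\<^sub>M prob_algebra T"
    and law: "has_conditional_law M S T X Y K" and markov: "markov_chain M R S T V X Y"
    and U[measurable]: "U \<in> sets R" and B[measurable]: "B \<in> sets S" and C[measurable]: "C \<in> sets T"
  shows "emeasure M {\<omega> \<in> space M. V \<omega> \<in> U \<and> X \<omega> \<in> B \<and> Y \<omega> \<in> C} =
    (\<integral>\<^sup>+ \<omega>. emeasure (K (X \<omega>)) C * indicator U (V \<omega>) * indicator B (X \<omega>) \<partial>M)"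
proof -
  interpret prob_space M by fact
  let ?FX = "vimage_algebra (space M) X S"
  let ?VX = "\<lambda>\<omega>. (V \<omega>, X \<omega>)"
  let ?FVX = "vimage_algebra (space M) ?VX (R \<Otimes>\<^sub>M S)"
  have VX[measurable]: "?VX \<in> M \<rightarrow>\<^sub>M R \<Otimes>\<^sub>M S"
    by measurable
  have subX: "subalgebra M ?FX" and subVX: "subalgebra M ?FVX"
    using measurable_sets[OF X] measurable_sets[OF VX] measurable_space[OF X] measurable_space[OF VX]
    by (auto simp: subalgebra_def sets_vimage_algebra2[OF measurable_space[THEN funcsetI]] sets_vimage_algebra2)
  interpret FX: finite_measure_subalgebra M ?FX
    by unfold_locales (rule subX)
  interpret FVX: finite_measure_subalgebra M ?FVX
    by unfold_locales (rule subVX)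
  have K'[measurable]: "K \<in> S \<rightarrow>\<^sub>M subprob_algebra T"
    using K by (rule measurable_prob_algebraD)
  let ?k = "\<lambda>\<omega>. measure (K (X \<omega>)) C"
  let ?f = "\<lambda>\<omega>. indicator C (Y \<omega>) :: real"
  have prob: "prob_space (K (X \<omega>))" if "\<omega> \<in> space M" for \<omega>
    using measurable_space[OF K measurable_space[OF X that]] by (simp add: space_prob_algebra)
  have em: "emeasure (K (X \<omega>)) C = ennreal (?k \<omega>)" if "\<omega> \<in> space M" for \<omega>
  proof -
    interpret Kx: prob_space "K (X \<omega>)" using prob[OF that] .
    show ?thesis by (rule Kx.emeasure_eq_measure)
  qed
  have k1: "?k \<omega> \<le> 1" if "\<omega> \<in> space M" for \<omega>
    using prob[OF that] by (rule prob_space.prob_le_1)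
  have kC[measurable]: "(\<lambda>x. measure (K x) C) \<in> borel_measurable S"
    by measurable
  have kX: "?k \<in> borel_measurable ?FX"
    by (rule measurable_compose[OF measurable_vimage_algebra1 kC])
       (use measurable_space[OF X] in auto)
  have int_f: "integrable M ?f"
    by (rule integrable_const_bound[where B=1]) (auto simp: indicator_def)
  have int_k: "integrable M ?k"
    by (rule integrable_const_bound[where B=1]) (use k1 in auto)
  \<comment> \<open>The kernel is a version of the conditional expectation: it has the right integral over every
    event \<open>X \<in> B'\<close>.\<close>
  have "AE \<omega> in M. real_cond_exp M ?FX ?f \<omega> = ?k \<omega>"
  proof (rule FX.real_cond_exp_charact[OF _ int_f int_k kX])
    fix A assume "A \<in> sets ?FX"
    then obtain B' where B'[measurable]: "B' \<in> sets S" and A: "A = X -` B' \<inter> space M"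
      using measurable_space[OF X] by (auto simp: sets_vimage_algebra2)
    have "ennreal (\<integral>\<omega>\<in>A. ?f \<omega> \<partial>M) = (\<integral>\<^sup>+\<omega>. ennreal (indicator A \<omega> * ?f \<omega>) \<partial>M)"
      unfolding set_lebesgue_integral_def A
      by (subst nn_integral_eq_integral)
         (auto intro!: integrable_const_bound[where B=1] simp: indicator_def)
    also have "\<dots> = (\<integral>\<^sup>+\<omega>. indicator {\<omega> \<in> space M. X \<omega> \<in> B' \<and> Y \<omega> \<in> C} \<omega> \<partial>M)"
      by (intro nn_integral_cong) (auto simp: A indicator_def)
    also have "\<dots> = emeasure M {\<omega> \<in> space M. X \<omega> \<in> B' \<and> Y \<omega> \<in> C}"
      by (intro nn_integral_indicator) measurable
    also have "\<dots> = (\<integral>\<^sup>+ \<omega>. emeasure (K (X \<omega>)) C * indicator B' (X \<omega>) \<partial>M)"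
      using law B' C by (auto simp: has_conditional_law_def)
    also have "\<dots> = (\<integral>\<^sup>+\<omega>. ennreal (indicator A \<omega> * ?k \<omega>) \<partial>M)"
      by (intro nn_integral_cong) (auto simp: A em indicator_def)
    also have "\<dots> = ennreal (\<integral>\<omega>\<in>A. ?k \<omega> \<partial>M)"
      unfolding set_lebesgue_integral_def A
      by (subst nn_integral_eq_integral)
         (auto intro!: integrable_const_bound[where B=1] simp: indicator_def k1)
    finally show "(\<integral>\<omega>\<in>A. ?f \<omega> \<partial>M) = (\<integral>\<omega>\<in>A. ?k \<omega> \<partial>M)"
      by (subst (asm) ennreal_inj) (auto simp: set_lebesgue_integral_def)
  qed
  moreover have "AE \<omega> in M. real_cond_exp M ?FVX ?f \<omega> = real_cond_exp M ?FX ?f \<omega>"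
    using markov C unfolding markov_chain_def by blast
  ultimately have k: "AE \<omega> in M. real_cond_exp M ?FVX ?f \<omega> = ?k \<omega>"
    by eventually_elim simp
  let ?A = "?VX -` (U \<times> B) \<inter> space M"
  have A: "?A \<in> sets ?FVX"
    by (rule in_vimage_algebra) simp
  have A'[measurable]: "?A \<in> sets M"
    using A subVX by (auto simp: subalgebra_def)
  have "emeasure M {\<omega> \<in> space M. V \<omega> \<in> U \<and> X \<omega> \<in> B \<and> Y \<omega> \<in> C} =
      (\<integral>\<^sup>+\<omega>. indicator {\<omega> \<in> space M. V \<omega> \<in> U \<and> X \<omega> \<in> B \<and> Y \<omega> \<in> C} \<omega> \<partial>M)"
    by (rule nn_integral_indicator[symmetric]) measurable
  also have "\<dots> = (\<integral>\<^sup>+\<omega>. ennreal (indicator ?A \<omega> * ?f \<omega>) \<partial>M)"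
    by (intro nn_integral_cong) (auto simp: indicator_def)
  also have "\<dots> = ennreal (\<integral>\<omega>\<in>?A. ?f \<omega> \<partial>M)"
    unfolding set_lebesgue_integral_def
    by (subst nn_integral_eq_integral)
       (auto intro!: integrable_const_bound[where B=1] simp: indicator_def)
  also have "(\<integral>\<omega>\<in>?A. ?f \<omega> \<partial>M) = (\<integral>\<omega>\<in>?A. real_cond_exp M ?FVX ?f \<omega> \<partial>M)"
    by (rule FVX.real_cond_exp_intA[OF int_f A])
  also have "\<dots> = (\<integral>\<omega>\<in>?A. ?k \<omega> \<partial>M)"
    unfolding set_lebesgue_integral_def
    by (rule integral_cong_AE) (use k in \<open>auto intro!: borel_measurable_scaleR\<close>)
  also have "ennreal \<dots> = (\<integral>\<^sup>+\<omega>. ennreal (indicator ?A \<omega> * ?k \<omega>) \<partial>M)"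
    unfolding set_lebesgue_integral_def
    by (subst nn_integral_eq_integral)
       (auto intro!: integrable_const_bound[where B=1] simp: indicator_def k1)
  also have "\<dots> = (\<integral>\<^sup>+ \<omega>. emeasure (K (X \<omega>)) C * indicator U (V \<omega>) * indicator B (X \<omega>) \<partial>M)"
    by (intro nn_integral_cong) (auto simp: em indicator_def)
  finally show ?thesis .
qed

text \<open>
  Conditionally on \<open>V\<close>, the pair \<open>(X, Y)\<close> is still generated by passing \<open>X\<close> through the channel.
  Both sides are finite measures in \<open>D\<close>, and they agree on rectangles, which generate the product
  \<open>\<sigma>\<close>-algebra and are closed under intersection. The right-hand side is made into a measure
  \<open>L\<close> first, so that the uniqueness theorem applies to it.
\<close>

lemma markov_joint_law:
  fixes V :: "'w \<Rightarrow> 'u" and X :: "'w \<Rightarrow> 'a" and Y :: "'w \<Rightarrow> 'b"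
  assumes "prob_space M"
    and V[measurable]: "V \<in> M \<rightarrow>\<^sub>M R" and X[measurable]: "X \<in> M \<rightarrow>\<^sub>M S"
    and Y[measurable]: "Y \<in> M \<rightarrow>\<^sub>M T" and K: "K \<in> S \<rightarrow>\<^sub>M prob_algebra T"
    and law: "has_conditional_law M S T X Y K" and markov: "markov_chain M R S T V X Y"
    and U[measurable]: "U \<in> sets R" and D: "D \<in> sets (S \<Otimes>\<^sub>M T)"
  shows "emeasure M {\<omega> \<in> space M. V \<omega> \<in> U \<and> (X \<omega>, Y \<omega>) \<in> D} =
    (\<integral>\<^sup>+ \<omega>. emeasure (K (X \<omega>)) (Pair (X \<omega>) -` D) * indicator U (V \<omega>) \<partial>M)"
proof -
  interpret prob_space M by fact
  have indV: "(\<lambda>\<omega>. indicator U (V \<omega>) :: ennreal) \<in> borel_measurable M"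
    by (rule measurable_compose[OF V]) simp
  have K'[measurable]: "K \<in> S \<rightarrow>\<^sub>M subprob_algebra T"
    using K by (rule measurable_prob_algebraD)
  have prob: "prob_space (K (X \<omega>))" and setsK: "sets (K (X \<omega>)) = sets T" if "\<omega> \<in> space M" for \<omega>
    using measurable_space[OF K measurable_space[OF X that]] by (simp_all add: space_prob_algebra)
  have cut: "Pair (X \<omega>) -` D \<in> sets (K (X \<omega>))" if "\<omega> \<in> space M" "D \<in> sets (S \<Otimes>\<^sub>M T)" for \<omega> D
    using that by (simp add: setsK sets_Pair1)
  have measS: "(\<lambda>x. emeasure (K x) (Pair x -` D)) \<in> borel_measurable S"
    if D: "D \<in> sets (S \<Otimes>\<^sub>M T)" for D
  proof (rule emeasure_measurable_subprob_algebra2[OF _ K'])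
    have "(SIGMA x:space S. Pair x -` D) = D"
      using sets.sets_into_space[OF D] by (auto simp: space_pair_measure)
    then show "(SIGMA x:space S. Pair x -` D) \<in> sets (S \<Otimes>\<^sub>M T)" using D by simp
  qed
  have meas[measurable]: "(\<lambda>\<omega>. emeasure (K (X \<omega>)) (Pair (X \<omega>) -` D)) \<in> borel_measurable M"
    if "D \<in> sets (S \<Otimes>\<^sub>M T)" for D
    using measurable_compose[OF X measS[OF that]] .
  define N where "N = distr (density M (\<lambda>\<omega>. indicator U (V \<omega>))) (S \<Otimes>\<^sub>M T) (\<lambda>\<omega>. (X \<omega>, Y \<omega>))"
  have N: "emeasure N D = emeasure M {\<omega> \<in> space M. V \<omega> \<in> U \<and> (X \<omega>, Y \<omega>) \<in> D}"
    if D[measurable]: "D \<in> sets (S \<Otimes>\<^sub>M T)" for D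
  proof -
    have "emeasure N D = (\<integral>\<^sup>+\<omega>. indicator U (V \<omega>) * indicator ((\<lambda>\<omega>. (X \<omega>, Y \<omega>)) -` D \<inter> space M) \<omega> \<partial>M)"
      unfolding N_def by (simp add: emeasure_distr emeasure_density)
    also have "\<dots> = (\<integral>\<^sup>+\<omega>. indicator {\<omega> \<in> space M. V \<omega> \<in> U \<and> (X \<omega>, Y \<omega>) \<in> D} \<omega> \<partial>M)"
      by (intro nn_integral_cong) (auto simp: indicator_def)
    also have "\<dots> = emeasure M {\<omega> \<in> space M. V \<omega> \<in> U \<and> (X \<omega>, Y \<omega>) \<in> D}"
      by (rule nn_integral_indicator) measurable
    finally show ?thesis .
  qed
  define L where "L = measure_of (space S \<times> space T) (sets (S \<Otimes>\<^sub>M T))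
     (\<lambda>D. \<integral>\<^sup>+ \<omega>. emeasure (K (X \<omega>)) (Pair (X \<omega>) -` D) * indicator U (V \<omega>) \<partial>M)"
  have setsL: "sets L = sets (S \<Otimes>\<^sub>M T)"
    unfolding L_def by (metis sets.sets_measure_of_eq space_pair_measure)
  have L: "emeasure L D = (\<integral>\<^sup>+ \<omega>. emeasure (K (X \<omega>)) (Pair (X \<omega>) -` D) * indicator U (V \<omega>) \<partial>M)"
    if "D \<in> sets (S \<Otimes>\<^sub>M T)" for D
  proof (rule emeasure_measure_of[OF L_def])
    show "countably_additive (sets L) (\<lambda>D. \<integral>\<^sup>+ \<omega>. emeasure (K (X \<omega>)) (Pair (X \<omega>) -` D) * indicator U (V \<omega>) \<partial>M)"
    proof (rule countably_additiveI)
      fix D :: "nat \<Rightarrow> ('a \<times> 'b) set"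
      assume "range D \<subseteq> sets L" and dis: "disjoint_family D"
      then have D: "D i \<in> sets (S \<Otimes>\<^sub>M T)" for i by (auto simp: setsL)
      have "(\<Sum>i. \<integral>\<^sup>+ \<omega>. emeasure (K (X \<omega>)) (Pair (X \<omega>) -` D i) * indicator U (V \<omega>) \<partial>M) =
         (\<integral>\<^sup>+ \<omega>. (\<Sum>i. emeasure (K (X \<omega>)) (Pair (X \<omega>) -` D i) * indicator U (V \<omega>)) \<partial>M)"
        by (intro nn_integral_suminf[symmetric] borel_measurable_times_ennreal meas D indV)
      also have "\<dots> = (\<integral>\<^sup>+ \<omega>. emeasure (K (X \<omega>)) (Pair (X \<omega>) -` (\<Union>i. D i)) * indicator U (V \<omega>) \<partial>M)"
      proof (rule nn_integral_cong)
        fix \<omega> assume w: "\<omega> \<in> space M"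
        have "(\<Sum>i. emeasure (K (X \<omega>)) (Pair (X \<omega>) -` D i)) = emeasure (K (X \<omega>)) (\<Union>i. Pair (X \<omega>) -` D i)"
          using dis cut[OF w D] by (intro suminf_emeasure) (auto simp: disjoint_family_on_def)
        then show "(\<Sum>i. emeasure (K (X \<omega>)) (Pair (X \<omega>) -` D i) * indicator U (V \<omega>)) =
          emeasure (K (X \<omega>)) (Pair (X \<omega>) -` (\<Union>i. D i)) * indicator U (V \<omega>)"
          by (simp add: vimage_UN)
      qed
      finally show "(\<Sum>i. \<integral>\<^sup>+ \<omega>. emeasure (K (X \<omega>)) (Pair (X \<omega>) -` D i) * indicator U (V \<omega>) \<partial>M) =
         (\<integral>\<^sup>+ \<omega>. emeasure (K (X \<omega>)) (Pair (X \<omega>) -` (\<Union>i. D i)) * indicator U (V \<omega>) \<partial>M)" .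
    qed
    show "sets (S \<Otimes>\<^sub>M T) \<subseteq> Pow (space S \<times> space T)"
      using sets.space_closed[of "S \<Otimes>\<^sub>M T"] by (simp add: space_pair_measure)
  qed (use that in \<open>auto simp: setsL positive_def\<close>)
  have rect: "emeasure N (B \<times> C) = emeasure L (B \<times> C)" if B: "B \<in> sets S" and C: "C \<in> sets T" for B C
  proof -
    have "emeasure N (B \<times> C) = emeasure M {\<omega> \<in> space M. V \<omega> \<in> U \<and> X \<omega> \<in> B \<and> Y \<omega> \<in> C}"
      using B C by (simp add: N)
    also have "\<dots> = (\<integral>\<^sup>+ \<omega>. emeasure (K (X \<omega>)) C * indicator U (V \<omega>) * indicator B (X \<omega>) \<partial>M)"
      by (rule markov_joint_law_rectangle[OF assms(1-8) B C])
    also have "\<dots> = (\<integral>\<^sup>+ \<omega>. emeasure (K (X \<omega>)) (Pair (X \<omega>) -` (B \<times> C)) * indicator U (V \<omega>) \<partial>M)"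
      by (intro nn_integral_cong) (auto simp: indicator_def vimage_def)
    also have "\<dots> = emeasure L (B \<times> C)"
      using B C by (simp add: L)
    finally show ?thesis .
  qed
  have "N = L"
  proof (rule measure_eqI_generator_eq[OF Int_stable_pair_measure_generator[of S T]])
    show "{a \<times> b |a b. a \<in> sets S \<and> b \<in> sets T} \<subseteq> Pow (space S \<times> space T)"
      by (auto dest: sets.sets_into_space)
    show "sets N = sigma_sets (space S \<times> space T) {a \<times> b |a b. a \<in> sets S \<and> b \<in> sets T}"
      "sets L = sigma_sets (space S \<times> space T) {a \<times> b |a b. a \<in> sets S \<and> b \<in> sets T}"
      unfolding setsL by (simp_all add: N_def sets_pair_measure)
    show "range (\<lambda>_::nat. space S \<times> space T) \<subseteq> {a \<times> b |a b. a \<in> sets S \<and> b \<in> sets T}"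
      by auto
    show "emeasure N (space S \<times> space T) \<noteq> \<infinity>"
      by (subst N) auto
  qed (use rect in auto)
  then show ?thesis
    using N[OF D] L[OF D] by simp
qed

section \<open>The channel ratio\<close>

text \<open>
  The first marginal of the joint law is the law of \<open>X\<close>, and by Fubini it has the density
  \<open>x \<mapsto> \<integral> g(x, y) P\<^sub>Y(dy)\<close> with respect to the law of \<open>X\<close> itself; so this density is \<open>1\<close> almost
  everywhere. This is where \<open>g\<close> being a likelihood ratio enters: for a typical codeword \<open>x\<close> it makes
  \<open>g(x, y)\<close> a probability density in \<open>y\<close> relative to the output law.
\<close>

lemma channel_ratio_integral:
  assumes "prob_space M" and X[measurable]: "X \<in> M \<rightarrow>\<^sub>M S" and Y[measurable]: "Y \<in> M \<rightarrow>\<^sub>M T"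
    and ratio: "is_channel_ratio M S T X Y g"
  shows "AE x in distr M S X. (\<integral>\<^sup>+ y. ennreal (g (x, y)) \<partial>distr M T Y) = 1"
proof -
  interpret prob_space M by fact
  interpret PX: prob_space "distr M S X" by (rule prob_space_distr[OF X])
  interpret PY: prob_space "distr M T Y" by (rule prob_space_distr[OF Y])
  have g[measurable]: "g \<in> borel_measurable (S \<Otimes>\<^sub>M T)"
    using ratio by (simp add: is_channel_ratio_def)
  have joint: "distr M (S \<Otimes>\<^sub>M T) (\<lambda>\<omega>. (X \<omega>, Y \<omega>)) =
       density (distr M S X \<Otimes>\<^sub>M distr M T Y) (\<lambda>z. ennreal (g z))"
    using ratio by (simp add: is_channel_ratio_def)
  show ?thesis
  proof (rule PX.density_unique2)
    fix B assume "B \<in> sets (distr M S X)"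
    then have B[measurable]: "B \<in> sets S" by simp
    have "(\<integral>\<^sup>+ x\<in>B. (\<integral>\<^sup>+ y. ennreal (g (x, y)) \<partial>distr M T Y) \<partial>distr M S X) =
      (\<integral>\<^sup>+ x. (\<integral>\<^sup>+ y. ennreal (g (x, y)) * indicator (B \<times> space T) (x, y) \<partial>distr M T Y) \<partial>distr M S X)"
      by (intro nn_integral_cong, subst nn_integral_multc[symmetric], simp)
         (auto intro!: nn_integral_cong simp: indicator_def)
    also have "\<dots> = (\<integral>\<^sup>+ z. ennreal (g z) * indicator (B \<times> space T) z \<partial>(distr M S X \<Otimes>\<^sub>M distr M T Y))"
      by (subst PY.nn_integral_fst[symmetric]) auto
    also have "\<dots> = emeasure (density (distr M S X \<Otimes>\<^sub>M distr M T Y) (\<lambda>z. ennreal (g z))) (B \<times> space T)"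
      by (subst emeasure_density) auto
    also have "\<dots> = emeasure (distr M (S \<Otimes>\<^sub>M T) (\<lambda>\<omega>. (X \<omega>, Y \<omega>))) (B \<times> space T)"
      by (simp add: joint)
    also have "\<dots> = emeasure (distr M S X) B"
      using measurable_space[OF Y]
      by (subst (1 2) emeasure_distr) (auto intro!: arg_cong[where f="emeasure M"])
    finally show "(\<integral>\<^sup>+ x\<in>B. (\<integral>\<^sup>+ y. ennreal (g (x, y)) \<partial>distr M T Y) \<partial>distr M S X) =
      (\<integral>\<^sup>+ x\<in>B. 1 \<partial>distr M S X)" by simp
  qed auto
qed

text \<open>
  A random variable almost surely avoids the zeros of its density. This makes the convention for
  \<open>ln 0\<close> harmless when the threshold on \<open>g\<close> is rewritten with logarithms.
\<close>

lemma channel_ratio_pos: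
  assumes X[measurable]: "X \<in> M \<rightarrow>\<^sub>M S" and Y[measurable]: "Y \<in> M \<rightarrow>\<^sub>M T"
    and ratio: "is_channel_ratio M S T X Y g"
  shows "AE \<omega> in M. 0 < g (X \<omega>, Y \<omega>)"
proof -
  have g[measurable]: "g \<in> borel_measurable (S \<Otimes>\<^sub>M T)"
    using ratio by (simp add: is_channel_ratio_def)
  have joint: "distr M (S \<Otimes>\<^sub>M T) (\<lambda>\<omega>. (X \<omega>, Y \<omega>)) =
       density (distr M S X \<Otimes>\<^sub>M distr M T Y) (\<lambda>z. ennreal (g z))"
    using ratio by (simp add: is_channel_ratio_def)
  have "AE z in distr M (S \<Otimes>\<^sub>M T) (\<lambda>\<omega>. (X \<omega>, Y \<omega>)). 0 < g z"
    unfolding joint by (subst AE_density) (auto simp: ennreal_less_zero_iff)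
  then show ?thesis
    by (subst (asm) AE_distr_iff) auto
qed

section \<open>Decoding by unique acceptance\<close>

text \<open>
  The decoder outputs the unique message whose acceptance set contains \<open>y\<close>, and \<open>b0\<close> when there is no
  such message. Its fibres are countable combinations of acceptance sets, which makes it measurable.
\<close>

lemma measurable_unique_decoder:
  assumes B: "countable B" "b0 \<in> B" and G: "\<And>v. v \<in> B \<Longrightarrow> G v \<in> sets T"
  obtains \<psi> where "\<psi> \<in> T \<rightarrow>\<^sub>M count_space B"
    "\<And>v y. v \<in> B \<Longrightarrow> y \<in> space T \<Longrightarrow> y \<in> G v \<Longrightarrow> (\<And>v'. v' \<in> B \<Longrightarrow> v' \<noteq> v \<Longrightarrow> y \<notin> G v') \<Longrightarrow> \<psi> y = v"
proof
  \<comment> \<open>\<open>U v\<close> is where only \<open>v\<close> accepts.\<close>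
  define U where "U v = G v - (\<Union>v'\<in>B - {v}. G v')" for v
  have U: "U v \<in> sets T" if "v \<in> B" for v
    unfolding U_def using that B G by (intro sets.Diff sets.countable_UN') auto
  have uniq: "v = v'" if "v \<in> B" "v' \<in> B" "y \<in> U v" "y \<in> U v'" for v v' y
    using that by (auto simp: U_def)
  define \<psi> where "\<psi> y = (if \<exists>v\<in>B. y \<in> U v then SOME v. v \<in> B \<and> y \<in> U v else b0)" for y
  have \<psi>: "\<psi> y = v" if "v \<in> B" "y \<in> U v" for v y
    using that uniq unfolding \<psi>_def by (auto intro!: some_equality)
  have \<psi>0: "\<psi> y = b0" if "\<not> (\<exists>v\<in>B. y \<in> U v)" for y
    using that unfolding \<psi>_def by auto
  have pre: "\<psi> -` {v} \<inter> space T = (if v = b0 then space T - (\<Union>v'\<in>B - {b0}. U v') else U v)"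
    if v: "v \<in> B" for v
  proof (rule set_eqI)
    fix y
    show "y \<in> \<psi> -` {v} \<inter> space T \<longleftrightarrow> y \<in> (if v = b0 then space T - (\<Union>v'\<in>B - {b0}. U v') else U v)"
    proof (cases "\<exists>v'\<in>B. y \<in> U v'")
      case True
      then obtain w where w: "w \<in> B" "y \<in> U w" by blast
      then have "y \<in> space T" using sets.sets_into_space[OF U] by blast
      moreover have "y \<in> U v' \<longleftrightarrow> v' = w" if "v' \<in> B" for v' using uniq w that by blast
      ultimately show ?thesis using \<psi>[OF w] w v B(2) by auto
    next
      case False
      then show ?thesis using \<psi>0[OF False] v by auto
    qed
  qed
  show "\<psi> \<in> T \<rightarrow>\<^sub>M count_space B"
    unfolding measurable_count_space_eq_countable[OF B(1)]
  proof (intro conjI ballI)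
    show "\<psi> \<in> space T \<rightarrow> B" using \<psi> \<psi>0 B(2) by (metis Pi_I)
    show "\<psi> -` {v} \<inter> space T \<in> sets T" if "v \<in> B" for v
      unfolding pre[OF that] using U that B by (auto intro!: sets.Diff sets.countable_UN')
  qed
  show "\<psi> y = v" if "v \<in> B" "y \<in> space T" "y \<in> G v" "\<And>v'. v' \<in> B \<Longrightarrow> v' \<noteq> v \<Longrightarrow> y \<notin> G v'" for v y
    using that by (intro \<psi>) (auto simp: U_def)
qed

section \<open>Product measures, averaging and countable sums\<close>

lemma distr_PiM_two_components:
  assumes Q: "\<And>i. i \<in> I \<Longrightarrow> prob_space (Q i)" and ij: "i \<in> I" "j \<in> I" "i \<noteq> j"
  shows "distr (PiM I Q) (Q i \<Otimes>\<^sub>M Q j) (\<lambda>c. (c i, c j)) = Q i \<Otimes>\<^sub>M Q j"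
proof (rule pair_measure_eqI[symmetric])
  show "sigma_finite_measure (Q i)" "sigma_finite_measure (Q j)"
    using Q ij by (auto intro!: prob_space_imp_sigma_finite)
  fix E F assume [measurable]: "E \<in> sets (Q i)" "F \<in> sets (Q j)"
  have [measurable]: "(\<lambda>c. (c i, c j)) \<in> PiM I Q \<rightarrow>\<^sub>M Q i \<Otimes>\<^sub>M Q j"
    using ij by measurable
  have "emeasure (distr (PiM I Q) (Q i \<Otimes>\<^sub>M Q j) (\<lambda>c. (c i, c j))) (E \<times> F) =
    emeasure (PiM I Q) (prod_emb I Q {i, j} (PiE {i, j} (\<lambda>k. if k = i then E else F)))"
    using ij by (subst emeasure_distr)
      (auto intro!: arg_cong[where f="emeasure (PiM I Q)"] simp: prod_emb_def space_PiM PiE_iff)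
  also have "\<dots> = (\<Prod>k\<in>{i, j}. emeasure (Q k) (if k = i then E else F))"
    using ij Q by (intro emeasure_PiM_emb) auto
  finally show "emeasure (Q i) E * emeasure (Q j) F =
      emeasure (distr (PiM I Q) (Q i \<Otimes>\<^sub>M Q j) (\<lambda>c. (c i, c j))) (E \<times> F)"
    using ij by simp
qed simp

text \<open>
  The step from random codes to a single code: a function cannot exceed its mean everywhere.
\<close>

lemma (in prob_space) exists_le_nn_integral:
  assumes f[measurable]: "f \<in> borel_measurable M" and b: "(\<integral>\<^sup>+ x. f x \<partial>M) \<le> b" "b < \<infinity>"
  shows "\<exists>x\<in>space M. f x \<le> b"
proof (rule ccontr)
  assume "\<not> ?thesis"
  then have less: "b < f x" if "x \<in> space M" for x using that by (auto simp: not_le)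
  have "\<not> (AE x in M. f x \<le> b)"
  proof
    assume "AE x in M. f x \<le> b"
    then have "AE x in M. False"
      using AE_space by eventually_elim (use less in force)
    then show False by simp
  qed
  then have "(\<integral>\<^sup>+ x. b \<partial>M) < (\<integral>\<^sup>+ x. f x \<partial>M)"
    using b less by (intro nn_integral_less) (auto simp: emeasure_space_1 intro!: AE_I2 less_imp_le)
  then show False using b by (simp add: emeasure_space_1)
qed

lemma borel_measurable_nn_integral_count_space:
  fixes f :: "'i \<Rightarrow> 'a \<Rightarrow> ennreal"
  assumes I: "countable I" and f: "\<And>i. i \<in> I \<Longrightarrow> f i \<in> borel_measurable M"
  shows "(\<lambda>x. \<integral>\<^sup>+ i. f i x \<partial>count_space I) \<in> borel_measurable M"
proof -
  interpret sigma_finite_measure "count_space I"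
    using I by (rule sigma_finite_measure_count_space_countable)
  have "(\<lambda>(i, x). f i x) \<in> borel_measurable (count_space I \<Otimes>\<^sub>M M)"
    using I f by (intro measurable_pair_measure_countable1) auto
  from measurable_compose[OF measurable_pair_swap' this]
  have "(\<lambda>(x, i). f i x) \<in> borel_measurable (M \<Otimes>\<^sub>M count_space I)"
    by (simp add: case_prod_beta')
  then show ?thesis by (rule borel_measurable_nn_integral)
qed

lemma emeasure_UN_le_nn_integral:
  assumes I: "countable I" and A: "\<And>i. i \<in> I \<Longrightarrow> A i \<in> sets M"
  shows "emeasure M (\<Union>i\<in>I. A i) \<le> (\<integral>\<^sup>+ i. emeasure M (A i) \<partial>count_space I)"
proof -
  have "emeasure M (\<Union>i\<in>I. A i) = (\<integral>\<^sup>+ x. indicator (\<Union>i\<in>I. A i) x \<partial>M)"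
    using A I by (intro nn_integral_indicator[symmetric] sets.countable_UN') auto
  also have "\<dots> \<le> (\<integral>\<^sup>+ x. (\<integral>\<^sup>+ i. indicator (A i) x \<partial>count_space I) \<partial>M)"
  proof (rule nn_integral_mono)
    fix x
    show "indicator (\<Union>i\<in>I. A i) x \<le> (\<integral>\<^sup>+ i. indicator (A i) x \<partial>count_space I)"
    proof (cases "\<exists>i\<in>I. x \<in> A i")
      case True
      then obtain i where "i \<in> I" "x \<in> A i" by blast
      then show ?thesis
        using nn_integral_ge_point[of i I "\<lambda>i. indicator (A i) x"] True by simp
    qed simp
  qed
  also have "\<dots> = (\<integral>\<^sup>+ i. (\<integral>\<^sup>+ x. indicator (A i) x \<partial>M) \<partial>count_space I)"
    using A by (intro nn_integral_count_space_nn_integral[OF I]) auto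
  also have "\<dots> = (\<integral>\<^sup>+ i. emeasure M (A i) \<partial>count_space I)"
    using A by (intro nn_integral_cong nn_integral_indicator) auto
  finally show ?thesis .
qed

text \<open>
  Error probabilities are real infinite sums, while the averaging argument computes with extended
  nonnegative integrals over the counting measure, where sums may be exchanged freely. This brings a
  bound back.
\<close>

lemma infsum_le_if_nn_integral_le:
  fixes f :: "'a \<Rightarrow> real"
  assumes f: "\<And>x. x \<in> B \<Longrightarrow> 0 \<le> f x" and b: "0 \<le> b"
    and le: "(\<integral>\<^sup>+ x. ennreal (f x) \<partial>count_space B) \<le> ennreal b"
  shows "infsum f B \<le> b"
proof -
  have fin: "sum f F \<le> b" if F: "finite F" "F \<subseteq> B" for F
  proof -
    have "ennreal (sum f F) = (\<integral>\<^sup>+ x. ennreal (f x) \<partial>count_space F)"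
      using F f by (subst nn_integral_count_space_finite) (auto simp: subset_iff sum_ennreal)
    also have "\<dots> = (\<integral>\<^sup>+ x. ennreal (f x) * indicator F x \<partial>count_space B)"
      using F by (auto simp: nn_integral_count_space_indicator indicator_def intro!: nn_integral_cong)
    also have "\<dots> \<le> (\<integral>\<^sup>+ x. ennreal (f x) \<partial>count_space B)"
      by (intro nn_integral_mono) (auto simp: indicator_def)
    finally show ?thesis
      using le b by (metis ennreal_le_iff order_trans)
  qed
  have "f summable_on B"
    using f fin by (intro nonneg_bdd_above_summable_on) (auto intro!: bdd_aboveI[where M=b])
  then show ?thesis
    by (rule infsum_le_finite_sums) (rule fin)
qed

section \<open>The random codebook\<close>

text \<open>
  One block of the source and of the channel: \<open>V\<close> is the message, \<open>X\<close> the channel input, \<open>Y\<close> the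
  output, and the real number \<open>a\<close> is the margin in the decoding threshold.
\<close>

locale random_coding = prob_space M for M :: "'w measure" +
  fixes B :: "'u set" and S :: "'a measure" and T :: "'b measure"
    and V :: "'w \<Rightarrow> 'u" and X :: "'w \<Rightarrow> 'a" and Y :: "'w \<Rightarrow> 'b"
    and K :: "'a \<Rightarrow> 'b measure" and g :: "'a \<times> 'b \<Rightarrow> real" and a :: real
  assumes countable_B: "countable B"
    and V[measurable]: "V \<in> M \<rightarrow>\<^sub>M count_space B"
    and X[measurable]: "X \<in> M \<rightarrow>\<^sub>M S"
    and Y[measurable]: "Y \<in> M \<rightarrow>\<^sub>M T"
    and K: "K \<in> S \<rightarrow>\<^sub>M prob_algebra T"
    and law: "has_conditional_law M S T X Y K"
    and markov: "markov_chain M (count_space B) S T V X Y"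
    and ratio: "is_channel_ratio M S T X Y g"
    and a_pos: "0 < a"
begin

definition p :: "'u \<Rightarrow> real" where
  "p v = prob {\<omega> \<in> space M. V \<omega> = v}"

text \<open>
  Codewords for \<open>v\<close> are drawn from the conditional law of \<open>X\<close> given \<open>V = v\<close>. A message of probability
  zero contributes nothing to the error, so the unconditional law of \<open>X\<close> can serve as its codeword law.
\<close>

definition codeword_law :: "'u \<Rightarrow> 'a measure" where
  "codeword_law v = distr (if 0 < p v then uniform_measure M {\<omega> \<in> space M. V \<omega> = v} else M) S X"

text \<open>
  The threshold is \<open>g(x, y) > a / p v\<close>, multiplied out: then a message of probability zero accepts no
  output.
\<close>

definition accepted :: "'a \<Rightarrow> 'u \<Rightarrow> 'b set" where
  "accepted x v = {y \<in> space T. a < g (x, y) * p v}"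

lemma K_subprob[measurable]: "K \<in> S \<rightarrow>\<^sub>M subprob_algebra T"
  using K by (rule measurable_prob_algebraD)

lemma
  assumes "x \<in> space S"
  shows prob_space_K: "prob_space (K x)" and sets_K: "sets (K x) = sets T"
    and space_K: "space (K x) = space T"
  using measurable_space[OF K assms] by (auto simp: space_prob_algebra dest: sets_eq_imp_space_eq)

lemma g_measurable[measurable]: "g \<in> borel_measurable (S \<Otimes>\<^sub>M T)"
  using ratio by (simp add: is_channel_ratio_def)

lemma event_V_eq[measurable]: "{\<omega> \<in> space M. V \<omega> = v} \<in> sets M"
proof (cases "v \<in> B")
  case True
  have "{\<omega> \<in> space M. V \<omega> = v} = V -` {v} \<inter> space M" by auto
  then show ?thesis using True by (simp add: measurable_sets[OF V])
next
  case False
  then have "{\<omega> \<in> space M. V \<omega> = v} = {}" using measurable_space[OF V] by auto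
  then show ?thesis by simp
qed

lemma p_nonneg[simp]: "0 \<le> p v"
  by (simp add: p_def)

lemma sum_p: "(\<integral>\<^sup>+ v. ennreal (p v) \<partial>count_space B) = 1"
proof -
  have "(\<integral>\<^sup>+ v. ennreal (p v) \<partial>count_space B) = (\<integral>\<^sup>+ v. emeasure M {\<omega> \<in> space M. V \<omega> = v} \<partial>count_space B)"
    by (simp add: p_def emeasure_eq_measure)
  also have "\<dots> = emeasure M (\<Union>v\<in>B. {\<omega> \<in> space M. V \<omega> = v})"
    by (rule emeasure_UN_countable[symmetric]) (auto simp: countable_B disjoint_family_on_def)
  also have "(\<Union>v\<in>B. {\<omega> \<in> space M. V \<omega> = v}) = space M"
    using measurable_space[OF V] by auto
  finally show ?thesis by (simp add: emeasure_space_1)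
qed

lemma AE_p_pos: "AE \<omega> in M. 0 < p (V \<omega>)"
proof -
  have "AE \<omega> in M. \<forall>v\<in>B. V \<omega> = v \<longrightarrow> 0 < p v"
  proof (rule AE_ball_countable'[OF _ countable_B])
    fix v
    show "AE \<omega> in M. V \<omega> = v \<longrightarrow> 0 < p v"
    proof (cases "p v = 0")
      case True
      then have "{\<omega> \<in> space M. V \<omega> = v} \<in> null_sets M"
        by (auto simp: null_sets_def p_def emeasure_eq_measure)
      from AE_not_in[OF this] AE_space show ?thesis
        by eventually_elim auto
    next
      case False
      then show ?thesis using p_nonneg[of v] by (simp add: less_le)
    qed
  qed
  with AE_space show ?thesis
    by eventually_elim (use measurable_space[OF V] in auto)
qed

lemma prob_space_codeword_law: "prob_space (codeword_law v)"
proof (cases "0 < p v")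
  case True
  then have "emeasure M {\<omega> \<in> space M. V \<omega> = v} \<noteq> 0"
    by (simp add: p_def emeasure_eq_measure)
  then have "prob_space (uniform_measure M {\<omega> \<in> space M. V \<omega> = v})"
    by (intro prob_space_uniform_measure) auto
  then show ?thesis
    using True by (simp add: codeword_law_def prob_space.prob_space_distr)
qed (simp add: codeword_law_def prob_space_distr)

lemma sets_codeword_law[simp, measurable_cong]: "sets (codeword_law v) = sets S"
  by (simp add: codeword_law_def)

lemma space_codeword_law[simp]: "space (codeword_law v) = space S"
  by (simp add: codeword_law_def)

text \<open>
  Weighting the conditional law by \<open>p v\<close> turns a mean over codewords for \<open>v\<close> into a mean over the part
  of the original space where \<open>V = v\<close>. In this form the identity holds also for \<open>p v = 0\<close>.
\<close>

lemma nn_integral_codeword_law: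
  assumes f[measurable]: "f \<in> borel_measurable S"
  shows "ennreal (p v) * (\<integral>\<^sup>+ x. f x \<partial>codeword_law v) = (\<integral>\<^sup>+ \<omega>. f (X \<omega>) * indicator {v} (V \<omega>) \<partial>M)"
proof (cases "0 < p v")
  case True
  let ?E = "{\<omega> \<in> space M. V \<omega> = v}"
  have em: "emeasure M ?E = ennreal (p v)"
    by (simp add: p_def emeasure_eq_measure)
  have "(\<integral>\<^sup>+ x. f x \<partial>codeword_law v) = (\<integral>\<^sup>+ \<omega>. f (X \<omega>) \<partial>uniform_measure M ?E)"
    using True by (simp add: codeword_law_def nn_integral_distr)
  also have "\<dots> = (\<integral>\<^sup>+ \<omega>. f (X \<omega>) * indicator ?E \<omega> \<partial>M) / ennreal (p v)"
    by (subst nn_integral_uniform_measure) (simp_all add: em)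
  also have "(\<integral>\<^sup>+ \<omega>. f (X \<omega>) * indicator ?E \<omega> \<partial>M) = (\<integral>\<^sup>+ \<omega>. f (X \<omega>) * indicator {v} (V \<omega>) \<partial>M)"
    by (intro nn_integral_cong) (auto simp: indicator_def)
  finally show ?thesis
    using True by (simp add: ennreal_times_divide mult_divide_eq_ennreal mult.commute[of "ennreal (p v)"])
next
  case False
  then have p0: "p v = 0" using p_nonneg[of v] by linarith
  then have "AE \<omega> in M. \<omega> \<notin> {\<omega> \<in> space M. V \<omega> = v}"
    by (subst AE_iff_null_sets[symmetric]) (auto simp: null_sets_def p_def emeasure_eq_measure)
  then have "AE \<omega> in M. f (X \<omega>) * indicator {v} (V \<omega>) = 0"
    using AE_space by eventually_elim auto
  then have "(\<integral>\<^sup>+ \<omega>. f (X \<omega>) * indicator {v} (V \<omega>) \<partial>M) = (\<integral>\<^sup>+ \<omega>. 0 \<partial>M)"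
    by (rule nn_integral_cong_AE)
  then show ?thesis by (simp add: p0)
qed

text \<open>
  Conditioning on an event of positive probability keeps null sets null. So each codeword law inherits
  the almost sure properties of the law of \<open>X\<close>.
\<close>

lemma AE_codeword_law:
  assumes "AE x in distr M S X. P x"
  shows "AE x in codeword_law v. P x"
proof -
  obtain N where N: "N \<in> sets S" "{x \<in> space S. \<not> P x} \<subseteq> N" "emeasure (distr M S X) N = 0"
    using assms by (auto elim!: AE_E)
  then have "AE x in distr M S X. x \<notin> N"
    by (intro AE_not_in) (auto simp: null_sets_def)
  then have ae: "AE \<omega> in M. X \<omega> \<notin> N"
    by (rule AE_distrD[OF X])
  have "AE x in codeword_law v. x \<notin> N"
    using N(1) ae unfolding codeword_law_def
    by (subst AE_distr_iff) (auto intro!: AE_uniform_measureI)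
  moreover have "AE x in codeword_law v. x \<in> space S"
    using AE_space[of "codeword_law v"] by simp
  ultimately show ?thesis
    by eventually_elim (use N(2) in auto)
qed

lemma accepted_sets[measurable]: "x \<in> space S \<Longrightarrow> accepted x v \<in> sets T"
  unfolding accepted_def by measurable

lemma K_accepted_measurable[measurable]:
  "(\<lambda>(x, x'). emeasure (K x) (accepted x' v)) \<in> borel_measurable (S \<Otimes>\<^sub>M S)"
proof -
  have "(SIGMA z:space (S \<Otimes>\<^sub>M S). accepted (snd z) v) =
    {w \<in> space ((S \<Otimes>\<^sub>M S) \<Otimes>\<^sub>M T). a < g (snd (fst w), snd w) * p v}"
    by (auto simp: accepted_def space_pair_measure)
  also have "\<dots> \<in> sets ((S \<Otimes>\<^sub>M S) \<Otimes>\<^sub>M T)"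
    by measurable
  finally have "(\<lambda>z. emeasure (K (fst z)) (accepted (snd z) v)) \<in> borel_measurable (S \<Otimes>\<^sub>M S)"
    by (rule emeasure_measurable_subprob_algebra2) measurable
  then show ?thesis by (simp add: case_prod_beta')
qed

lemma K_rejected_measurable[measurable]:
  "(\<lambda>x. emeasure (K x) (space T - accepted x v)) \<in> borel_measurable S"
proof -
  have "(SIGMA x:space S. space T - accepted x v) = {w \<in> space (S \<Otimes>\<^sub>M T). \<not> a < g w * p v}"
    by (auto simp: accepted_def space_pair_measure)
  also have "\<dots> \<in> sets (S \<Otimes>\<^sub>M T)"
    by measurable
  finally show ?thesis
    by (rule emeasure_measurable_subprob_algebra2) measurable
qed

lemma p_V_measurable[measurable]: "(\<lambda>\<omega>. p (V \<omega>)) \<in> borel_measurable M"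
  by (rule measurable_compose[OF V]) simp

section \<open>Errors of the random codebook\<close>

text \<open>
  A codeword drawn given \<open>V = v\<close> and sent through the channel reproduces, by the Markov property, the
  conditional law of \<open>(X, Y)\<close> given \<open>V = v\<close>. Summing over \<open>v\<close>, the mean probability that the transmitted
  message is not accepted is the probability of the threshold event for the original triple.
\<close>

lemma expected_rejection:
  "(\<integral>\<^sup>+ v. ennreal (p v) * (\<integral>\<^sup>+ x. emeasure (K x) (space T - accepted x v) \<partial>codeword_law v) \<partial>count_space B)
    = emeasure M {\<omega> \<in> space M. g (X \<omega>, Y \<omega>) * p (V \<omega>) \<le> a}"
proof -
  let ?E = "\<lambda>v. {\<omega> \<in> space M. V \<omega> = v \<and> g (X \<omega>, Y \<omega>) * p v \<le> a}"
  have "ennreal (p v) * (\<integral>\<^sup>+ x. emeasure (K x) (space T - accepted x v) \<partial>codeword_law v) = emeasure M (?E v)"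
    if v: "v \<in> B" for v
  proof -
    let ?D = "{z \<in> space (S \<Otimes>\<^sub>M T). g z * p v \<le> a}"
    have "ennreal (p v) * (\<integral>\<^sup>+ x. emeasure (K x) (space T - accepted x v) \<partial>codeword_law v) =
      (\<integral>\<^sup>+ \<omega>. emeasure (K (X \<omega>)) (space T - accepted (X \<omega>) v) * indicator {v} (V \<omega>) \<partial>M)"
      by (rule nn_integral_codeword_law) measurable
    also have "\<dots> = (\<integral>\<^sup>+ \<omega>. emeasure (K (X \<omega>)) (Pair (X \<omega>) -` ?D) * indicator {v} (V \<omega>) \<partial>M)"
      using measurable_space[OF X]
      by (intro nn_integral_cong arg_cong2[where f="(*)"] arg_cong2[where f=emeasure])
         (auto simp: accepted_def space_pair_measure)
    also have "\<dots> = emeasure M {\<omega> \<in> space M. V \<omega> \<in> {v} \<and> (X \<omega>, Y \<omega>) \<in> ?D}"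
      using v by (intro markov_joint_law[OF prob_space_axioms V X Y K law markov, symmetric]) auto
    also have "{\<omega> \<in> space M. V \<omega> \<in> {v} \<and> (X \<omega>, Y \<omega>) \<in> ?D} = ?E v"
      using measurable_space[OF X] measurable_space[OF Y] by (auto simp: space_pair_measure)
    finally show ?thesis .
  qed
  then have "(\<integral>\<^sup>+ v. ennreal (p v) * (\<integral>\<^sup>+ x. emeasure (K x) (space T - accepted x v) \<partial>codeword_law v) \<partial>count_space B)
    = (\<integral>\<^sup>+ v. emeasure M (?E v) \<partial>count_space B)"
    by (intro nn_integral_cong) auto
  also have "\<dots> = emeasure M (\<Union>v\<in>B. ?E v)"
  proof (rule emeasure_UN_countable[symmetric])
    fix v
    have "?E v = {\<omega> \<in> space M. V \<omega> = v} \<inter> {\<omega> \<in> space M. g (X \<omega>, Y \<omega>) * p v \<le> a}" by auto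
    also have "\<dots> \<in> sets M" by measurable
    finally show "?E v \<in> sets M" .
  qed (auto simp: countable_B disjoint_family_on_def)
  also have "(\<Union>v\<in>B. ?E v) = {\<omega> \<in> space M. g (X \<omega>, Y \<omega>) * p (V \<omega>) \<le> a}"
    using measurable_space[OF V] by auto
  finally show ?thesis .
qed

text \<open>
  Drawing the message and then its random codeword produces an output with the law of \<open>Y\<close>. Hence an
  output that is independent of some competing codeword can be treated as a sample of \<open>Y\<close>.
\<close>

lemma output_law_mixture:
  assumes C[measurable]: "C \<in> sets T"
  shows "(\<integral>\<^sup>+ v. ennreal (p v) * (\<integral>\<^sup>+ x. emeasure (K x) C \<partial>codeword_law v) \<partial>count_space B)
    = emeasure (distr M T Y) C"
proof -
  have "(\<integral>\<^sup>+ v. ennreal (p v) * (\<integral>\<^sup>+ x. emeasure (K x) C \<partial>codeword_law v) \<partial>count_space B)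
    = (\<integral>\<^sup>+ v. (\<integral>\<^sup>+ \<omega>. emeasure (K (X \<omega>)) C * indicator {v} (V \<omega>) \<partial>M) \<partial>count_space B)"
    by (intro nn_integral_cong nn_integral_codeword_law) measurable
  also have "\<dots> = (\<integral>\<^sup>+ \<omega>. (\<integral>\<^sup>+ v. emeasure (K (X \<omega>)) C * indicator {v} (V \<omega>) \<partial>count_space B) \<partial>M)"
  proof (rule nn_integral_count_space_nn_integral[symmetric, OF countable_B])
    fix v
    have "(\<lambda>\<omega>. indicator {v} (V \<omega>) :: ennreal) \<in> borel_measurable M"
      by (rule measurable_compose[OF V]) simp
    then show "(\<lambda>\<omega>. emeasure (K (X \<omega>)) C * indicator {v} (V \<omega>)) \<in> borel_measurable M"
      by measurable
  qed
  also have "\<dots> = (\<integral>\<^sup>+ \<omega>. emeasure (K (X \<omega>)) C * indicator (space S) (X \<omega>) \<partial>M)"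
  proof (rule nn_integral_cong)
    fix \<omega> assume w: "\<omega> \<in> space M"
    have "(\<integral>\<^sup>+ v. indicator {v} (V \<omega>) \<partial>count_space B) = (\<integral>\<^sup>+ v. indicator {V \<omega>} v \<partial>count_space B)"
      by (intro nn_integral_cong) (auto simp: indicator_def)
    also have "\<dots> = 1"
      using measurable_space[OF V w] by (subst nn_integral_indicator) auto
    finally show "(\<integral>\<^sup>+ v. emeasure (K (X \<omega>)) C * indicator {v} (V \<omega>) \<partial>count_space B) =
      emeasure (K (X \<omega>)) C * indicator (space S) (X \<omega>)"
      using measurable_space[OF X w] by (simp add: nn_integral_cmult)
  qed
  also have "\<dots> = emeasure M {\<omega> \<in> space M. X \<omega> \<in> space S \<and> Y \<omega> \<in> C}"
    using law C by (auto simp: has_conditional_law_def)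
  also have "\<dots> = emeasure (distr M T Y) C"
    using measurable_space[OF X] by (subst emeasure_distr) (auto intro!: arg_cong[where f="emeasure M"])
  finally show ?thesis .
qed

text \<open>
  Markov's inequality for \<open>g(x, y)\<close>, whose mean under the output law is \<open>1\<close> for almost every codeword
  \<open>x\<close>.
\<close>

lemma accepted_measure_le:
  "AE x in codeword_law v. emeasure (distr M T Y) (accepted x v) \<le> ennreal (p v / a)"
proof (rule AE_codeword_law)
  have "AE x in distr M S X. x \<in> space S"
    using AE_space[of "distr M S X"] by simp
  then show "AE x in distr M S X. emeasure (distr M T Y) (accepted x v) \<le> ennreal (p v / a)"
    using channel_ratio_integral[OF prob_space_axioms X Y ratio]
  proof eventually_elim
    case (elim x)
    then have x[measurable]: "x \<in> space S" and int: "(\<integral>\<^sup>+ y. ennreal (g (x, y)) \<partial>distr M T Y) = 1" by auto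
    have "emeasure (distr M T Y) (accepted x v) \<le>
      emeasure (distr M T Y) {y \<in> space T. 1 \<le> ennreal (p v / a) * ennreal (g (x, y))}"
    proof (rule emeasure_mono)
      show "accepted x v \<subseteq> {y \<in> space T. 1 \<le> ennreal (p v / a) * ennreal (g (x, y))}"
      proof
        fix y assume "y \<in> accepted x v"
        then have y: "y \<in> space T" and less: "a < g (x, y) * p v" by (auto simp: accepted_def)
        have "1 \<le> p v / a * g (x, y)"
          using less a_pos by (simp add: field_simps)
        then have "1 \<le> ennreal (p v / a * g (x, y))"
          by (metis ennreal_1 ennreal_leI)
        also have "\<dots> = ennreal (p v / a) * ennreal (g (x, y))"
          using a_pos by (intro ennreal_mult') simp
        finally show "y \<in> {y \<in> space T. 1 \<le> ennreal (p v / a) * ennreal (g (x, y))}" using y by simp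
      qed
    qed measurable
    also have "\<dots> \<le> ennreal (p v / a) * (\<integral>\<^sup>+ y. ennreal (g (x, y)) * indicator (space T) y \<partial>distr M T Y)"
      using nn_integral_Markov_inequality[of "\<lambda>y. ennreal (g (x, y))" "space T" "distr M T Y" "ennreal (p v / a)"]
      by (simp add: sets.sets_into_space Int_def conj_commute)
    also have "(\<integral>\<^sup>+ y. ennreal (g (x, y)) * indicator (space T) y \<partial>distr M T Y) = 1"
      unfolding int[symmetric] by (intro nn_integral_cong) simp
    finally show ?case by simp
  qed
qed

text \<open>
  An independent codeword for \<open>v'\<close> accepts the output with probability at most \<open>p v' / a\<close>. Because the
  thresholds are adapted to the probabilities of the messages, these bounds have the finite sum
  \<open>1 / a\<close>, although there may be infinitely many messages.
\<close>

lemma expected_confusion: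
  "(\<integral>\<^sup>+ v'. (\<integral>\<^sup>+ x'. (\<integral>\<^sup>+ v. ennreal (p v) * (\<integral>\<^sup>+ x. emeasure (K x) (accepted x' v') \<partial>codeword_law v)
      \<partial>count_space B) \<partial>codeword_law v') \<partial>count_space B) \<le> ennreal (1 / a)"
proof -
  have "(\<integral>\<^sup>+ x'. (\<integral>\<^sup>+ v. ennreal (p v) * (\<integral>\<^sup>+ x. emeasure (K x) (accepted x' v') \<partial>codeword_law v)
      \<partial>count_space B) \<partial>codeword_law v') \<le> ennreal (1 / a) * ennreal (p v')" for v'
  proof -
    interpret Q: prob_space "codeword_law v'" by (rule prob_space_codeword_law)
    have "(\<integral>\<^sup>+ x'. (\<integral>\<^sup>+ v. ennreal (p v) * (\<integral>\<^sup>+ x. emeasure (K x) (accepted x' v') \<partial>codeword_law v)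
        \<partial>count_space B) \<partial>codeword_law v') =
      (\<integral>\<^sup>+ x'. emeasure (distr M T Y) (accepted x' v') \<partial>codeword_law v')"
      by (intro nn_integral_cong output_law_mixture accepted_sets) simp
    also have "\<dots> \<le> (\<integral>\<^sup>+ x'. ennreal (p v' / a) \<partial>codeword_law v')"
      by (rule nn_integral_mono_AE[OF accepted_measure_le])
    also have "\<dots> = ennreal (1 / a) * ennreal (p v')"
      using a_pos by (simp add: Q.emeasure_space_1[simplified] ennreal_mult'[symmetric])
    finally show ?thesis .
  qed
  then have "(\<integral>\<^sup>+ v'. (\<integral>\<^sup>+ x'. (\<integral>\<^sup>+ v. ennreal (p v) * (\<integral>\<^sup>+ x. emeasure (K x) (accepted x' v') \<partial>codeword_law v)
      \<partial>count_space B) \<partial>codeword_law v') \<partial>count_space B) \<le>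
    (\<integral>\<^sup>+ v'. ennreal (1 / a) * ennreal (p v') \<partial>count_space B)"
    by (intro nn_integral_mono)
  then show ?thesis
    by (simp add: nn_integral_cmult sum_p)
qed

text \<open>
  The union bound for the error probability of the codebook \<open>c\<close>: either the transmitted message \<open>v\<close>
  rejects the output, or a different message \<open>v'\<close> accepts it.
\<close>

definition error_bound :: "('u \<Rightarrow> 'a) \<Rightarrow> ennreal" where
  "error_bound c =
     (\<integral>\<^sup>+ v. ennreal (p v) * emeasure (K (c v)) (space T - accepted (c v) v) \<partial>count_space B) +
     (\<integral>\<^sup>+ v'. (\<integral>\<^sup>+ v. (if v = v' then 0 else ennreal (p v) * emeasure (K (c v)) (accepted (c v') v'))
        \<partial>count_space B) \<partial>count_space B)"

lemma measurable_codeword[measurable]: "v \<in> B \<Longrightarrow> (\<lambda>c. c v) \<in> PiM B codeword_law \<rightarrow>\<^sub>M S"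
  using measurable_component_singleton[of v B codeword_law]
  by (simp cong: measurable_cong_sets)

lemma rejected_term_measurable:
  "v \<in> B \<Longrightarrow> (\<lambda>c. ennreal (p v) * emeasure (K (c v)) (space T - accepted (c v) v))
    \<in> borel_measurable (PiM B codeword_law)"
  by measurable

lemma confused_term_measurable:
  assumes "v \<in> B" "v' \<in> B"
  shows "(\<lambda>c. if v = v' then 0 else ennreal (p v) * emeasure (K (c v)) (accepted (c v') v'))
    \<in> borel_measurable (PiM B codeword_law)"
proof -
  have "(\<lambda>c. (c v, c v')) \<in> PiM B codeword_law \<rightarrow>\<^sub>M S \<Otimes>\<^sub>M S"
    using assms by measurable
  from measurable_compose[OF this K_accepted_measurable]
  have "(\<lambda>c. emeasure (K (c v)) (accepted (c v') v')) \<in> borel_measurable (PiM B codeword_law)" by simp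
  then show ?thesis by simp
qed

text \<open>
  Codewords of different messages are independent. So the mean over codebooks becomes an iterated one,
  in which the competing codeword \<open>x'\<close> is held fixed while the transmitted codeword is averaged out.
\<close>

lemma expected_confusion_pair:
  assumes v: "v \<in> B" "v' \<in> B" "v \<noteq> v'"
  shows "(\<integral>\<^sup>+ c. emeasure (K (c v)) (accepted (c v') v') \<partial>PiM B codeword_law) =
    (\<integral>\<^sup>+ x'. (\<integral>\<^sup>+ x. emeasure (K x) (accepted x' v') \<partial>codeword_law v) \<partial>codeword_law v')"
proof -
  interpret Q: prob_space "codeword_law v" by (rule prob_space_codeword_law)
  interpret Q': prob_space "codeword_law v'" by (rule prob_space_codeword_law)
  interpret QQ: pair_sigma_finite "codeword_law v" "codeword_law v'" ..
  let ?h = "\<lambda>(x, x'). emeasure (K x) (accepted x' v')"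
  have h: "?h \<in> borel_measurable (codeword_law v \<Otimes>\<^sub>M codeword_law v')"
    by measurable
  have pr: "(\<lambda>c. (c v, c v')) \<in> PiM B codeword_law \<rightarrow>\<^sub>M codeword_law v \<Otimes>\<^sub>M codeword_law v'"
    using v by measurable
  have "(\<integral>\<^sup>+ c. emeasure (K (c v)) (accepted (c v') v') \<partial>PiM B codeword_law) =
    (\<integral>\<^sup>+ z. ?h z \<partial>distr (PiM B codeword_law) (codeword_law v \<Otimes>\<^sub>M codeword_law v') (\<lambda>c. (c v, c v')))"
    by (subst nn_integral_distr[OF pr]) (simp_all add: h)
  also have "\<dots> = (\<integral>\<^sup>+ z. ?h z \<partial>(codeword_law v \<Otimes>\<^sub>M codeword_law v'))"
    by (subst distr_PiM_two_components[OF prob_space_codeword_law v]) simp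
  also have "\<dots> = (\<integral>\<^sup>+ x'. (\<integral>\<^sup>+ x. emeasure (K x) (accepted x' v') \<partial>codeword_law v) \<partial>codeword_law v')"
    by (subst QQ.nn_integral_snd[OF h, symmetric]) simp
  finally show ?thesis .
qed

lemma
  shows measurable_rejection_sum: "(\<lambda>c. \<integral>\<^sup>+ v. ennreal (p v) *
      emeasure (K (c v)) (space T - accepted (c v) v) \<partial>count_space B) \<in> borel_measurable (PiM B codeword_law)"
    and measurable_confusion_sum: "v' \<in> B \<Longrightarrow> (\<lambda>c. \<integral>\<^sup>+ v. (if v = v' then 0 else
      ennreal (p v) * emeasure (K (c v)) (accepted (c v') v')) \<partial>count_space B) \<in> borel_measurable (PiM B codeword_law)"
    and measurable_confusion_double_sum: "(\<lambda>c. \<integral>\<^sup>+ v'. (\<integral>\<^sup>+ v. (if v = v' then 0 else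
      ennreal (p v) * emeasure (K (c v)) (accepted (c v') v')) \<partial>count_space B) \<partial>count_space B)
      \<in> borel_measurable (PiM B codeword_law)"
  by (rule borel_measurable_nn_integral_count_space[OF countable_B]
        rejected_term_measurable confused_term_measurable; assumption?)+

lemma error_bound_measurable: "error_bound \<in> borel_measurable (PiM B codeword_law)"
  using borel_measurable_add[OF measurable_rejection_sum measurable_confusion_double_sum]
  unfolding error_bound_def[abs_def] .

text \<open>
  The mean of the union bound over independent codewords. The terms with \<open>v = v'\<close> are added to the
  double sum before it is bounded; they complete the sum over \<open>v\<close> to the full output law.
\<close>

lemma expected_error_bound:
  "(\<integral>\<^sup>+ c. error_bound c \<partial>PiM B codeword_law) \<le>
    emeasure M {\<omega> \<in> space M. g (X \<omega>, Y \<omega>) * p (V \<omega>) \<le> a} + ennreal (1 / a)"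
proof -
  let ?P = "PiM B codeword_law"
  let ?r = "\<lambda>v c. ennreal (p v) * emeasure (K (c v)) (space T - accepted (c v) v)"
  let ?q = "\<lambda>v v' c. if v = v' then 0 else ennreal (p v) * emeasure (K (c v)) (accepted (c v') v')"
  have "(\<integral>\<^sup>+ c. error_bound c \<partial>?P) =
    (\<integral>\<^sup>+ c. (\<integral>\<^sup>+ v. ?r v c \<partial>count_space B) \<partial>?P) +
    (\<integral>\<^sup>+ c. (\<integral>\<^sup>+ v'. (\<integral>\<^sup>+ v. ?q v v' c \<partial>count_space B) \<partial>count_space B) \<partial>?P)"
    unfolding error_bound_def by (rule nn_integral_add[OF measurable_rejection_sum measurable_confusion_double_sum])
  also have "(\<integral>\<^sup>+ c. (\<integral>\<^sup>+ v. ?r v c \<partial>count_space B) \<partial>?P) = (\<integral>\<^sup>+ v. (\<integral>\<^sup>+ c. ?r v c \<partial>?P) \<partial>count_space B)"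
    by (rule nn_integral_count_space_nn_integral[OF countable_B rejected_term_measurable])
  also have "\<dots> = (\<integral>\<^sup>+ v. ennreal (p v) * (\<integral>\<^sup>+ x. emeasure (K x) (space T - accepted x v) \<partial>codeword_law v) \<partial>count_space B)"
  proof (rule nn_integral_cong)
    fix v assume "v \<in> space (count_space B)"
    then have v[measurable]: "v \<in> B" by simp
    have "(\<integral>\<^sup>+ x. emeasure (K x) (space T - accepted x v) \<partial>codeword_law v) =
      (\<integral>\<^sup>+ x. emeasure (K x) (space T - accepted x v) \<partial>distr ?P (codeword_law v) (\<lambda>c. c v))"
      by (subst distr_PiM_component[OF prob_space_codeword_law v]) simp
    also have "\<dots> = (\<integral>\<^sup>+ c. emeasure (K (c v)) (space T - accepted (c v) v) \<partial>?P)"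
      by (subst nn_integral_distr[OF measurable_component_singleton[OF v]]) (simp_all add: K_rejected_measurable cong: measurable_cong_sets)
    finally show "(\<integral>\<^sup>+ c. ?r v c \<partial>?P) =
        ennreal (p v) * (\<integral>\<^sup>+ x. emeasure (K x) (space T - accepted x v) \<partial>codeword_law v)"
      by (simp add: nn_integral_cmult measurable_compose[OF measurable_codeword[OF v] K_rejected_measurable])
  qed
  also have "\<dots> = emeasure M {\<omega> \<in> space M. g (X \<omega>, Y \<omega>) * p (V \<omega>) \<le> a}"
    by (rule expected_rejection)
  also have "(\<integral>\<^sup>+ c. (\<integral>\<^sup>+ v'. (\<integral>\<^sup>+ v. ?q v v' c \<partial>count_space B) \<partial>count_space B) \<partial>?P) =
    (\<integral>\<^sup>+ v'. (\<integral>\<^sup>+ c. (\<integral>\<^sup>+ v. ?q v v' c \<partial>count_space B) \<partial>?P) \<partial>count_space B)"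
    by (rule nn_integral_count_space_nn_integral[OF countable_B measurable_confusion_sum])
  also have "\<dots> \<le> (\<integral>\<^sup>+ v'. (\<integral>\<^sup>+ x'. (\<integral>\<^sup>+ v. ennreal (p v) * (\<integral>\<^sup>+ x. emeasure (K x) (accepted x' v') \<partial>codeword_law v)
      \<partial>count_space B) \<partial>codeword_law v') \<partial>count_space B)"
  proof (rule nn_integral_mono)
    fix v' assume "v' \<in> space (count_space B)"
    then have v': "v' \<in> B" by simp
    have meas_x'[measurable]: "(\<lambda>x'. \<integral>\<^sup>+ x. emeasure (K x) (accepted x' v') \<partial>codeword_law v) \<in> borel_measurable (codeword_law v')" for v
    proof -
      interpret Q: prob_space "codeword_law v" by (rule prob_space_codeword_law)
      have "(\<lambda>z. case z of (x', x) \<Rightarrow> emeasure (K x) (accepted x' v')) \<in> borel_measurable (codeword_law v' \<Otimes>\<^sub>M codeword_law v)"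
        using measurable_compose[OF measurable_pair_swap' K_accepted_measurable[of v']]
        by (simp add: case_prod_beta' cong: measurable_cong_sets)
      then show ?thesis by (rule Q.borel_measurable_nn_integral)
    qed
    have "(\<integral>\<^sup>+ c. (\<integral>\<^sup>+ v. ?q v v' c \<partial>count_space B) \<partial>?P) = (\<integral>\<^sup>+ v. (\<integral>\<^sup>+ c. ?q v v' c \<partial>?P) \<partial>count_space B)"
      by (rule nn_integral_count_space_nn_integral[OF countable_B confused_term_measurable[OF _ v']])
    also have "\<dots> \<le> (\<integral>\<^sup>+ v. (\<integral>\<^sup>+ x'. ennreal (p v) * (\<integral>\<^sup>+ x. emeasure (K x) (accepted x' v') \<partial>codeword_law v) \<partial>codeword_law v') \<partial>count_space B)"
    proof (rule nn_integral_mono)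
      fix v assume "v \<in> space (count_space B)"
      then have v: "v \<in> B" by simp
      show "(\<integral>\<^sup>+ c. ?q v v' c \<partial>?P) \<le> (\<integral>\<^sup>+ x'. ennreal (p v) * (\<integral>\<^sup>+ x. emeasure (K x) (accepted x' v') \<partial>codeword_law v) \<partial>codeword_law v')"
      proof (cases "v = v'")
        case False
        have "(\<lambda>c. emeasure (K (c v)) (accepted (c v') v')) \<in> borel_measurable ?P"
          using measurable_compose[OF measurable_Pair[OF measurable_codeword[OF v] measurable_codeword[OF v']] K_accepted_measurable[of v']]
          by simp
        then show ?thesis
          using False by (simp add: nn_integral_cmult meas_x' expected_confusion_pair[OF v v'])
      qed simp
    qed
    also have "\<dots> = (\<integral>\<^sup>+ x'. (\<integral>\<^sup>+ v. ennreal (p v) * (\<integral>\<^sup>+ x. emeasure (K x) (accepted x' v') \<partial>codeword_law v) \<partial>count_space B) \<partial>codeword_law v')"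
      by (rule nn_integral_count_space_nn_integral[symmetric, OF countable_B]) measurable
    finally show "(\<integral>\<^sup>+ c. (\<integral>\<^sup>+ v. ?q v v' c \<partial>count_space B) \<partial>?P) \<le>
      (\<integral>\<^sup>+ x'. (\<integral>\<^sup>+ v. ennreal (p v) * (\<integral>\<^sup>+ x. emeasure (K x) (accepted x' v') \<partial>codeword_law v) \<partial>count_space B) \<partial>codeword_law v')" .
  qed
  also have "\<dots> \<le> ennreal (1 / a)"
    by (rule expected_confusion)
  finally show ?thesis by (simp add: add_left_mono)
qed

section \<open>A good deterministic code\<close>

text \<open>
  Some codebook is at most as bad as the average one. It is used as the encoder, with the decoder that
  looks for a unique accepting message.
\<close>

lemma exists_code:
  obtains \<phi> \<psi> where "\<phi> \<in> B \<rightarrow> space S" "\<psi> \<in> T \<rightarrow>\<^sub>M count_space B"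
    "(\<Sum>\<^sub>\<infinity>v\<in>B. p v * measure (K (\<phi> v)) {y \<in> space T. \<psi> y \<noteq> v}) \<le>
      prob {\<omega> \<in> space M. g (X \<omega>, Y \<omega>) * p (V \<omega>) \<le> a} + 1 / a"
proof -
  let ?P = "PiM B codeword_law"
  let ?b = "prob {\<omega> \<in> space M. g (X \<omega>, Y \<omega>) * p (V \<omega>) \<le> a} + 1 / a"
  interpret P: prob_space ?P
    by (rule prob_space_PiM) (rule prob_space_codeword_law)
  have bound: "emeasure M {\<omega> \<in> space M. g (X \<omega>, Y \<omega>) * p (V \<omega>) \<le> a} + ennreal (1 / a) = ennreal ?b"
    using a_pos by (simp add: emeasure_eq_measure)
  obtain c where c: "c \<in> space ?P" and le: "error_bound c \<le> ennreal ?b"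
    using P.exists_le_nn_integral[OF error_bound_measurable expected_error_bound] unfolding bound by auto
  have cS: "c v \<in> space S" if "v \<in> B" for v
    using c that by (auto simp: space_PiM PiE_iff)
  obtain \<omega>0 where "\<omega>0 \<in> space M" using not_empty by blast
  then have b0: "V \<omega>0 \<in> B" using measurable_space[OF V] by simp
  obtain \<psi> where \<psi>: "\<psi> \<in> T \<rightarrow>\<^sub>M count_space B"
    and dec: "\<And>v y. v \<in> B \<Longrightarrow> y \<in> space T \<Longrightarrow> y \<in> accepted (c v) v \<Longrightarrow>
      (\<And>v'. v' \<in> B \<Longrightarrow> v' \<noteq> v \<Longrightarrow> y \<notin> accepted (c v') v') \<Longrightarrow> \<psi> y = v"
    by (rule measurable_unique_decoder[OF countable_B b0, of "\<lambda>v. accepted (c v) v" T, OF accepted_sets[OF cS]]) blast+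
  let ?q = "\<lambda>v v'. if v = v' then 0 else ennreal (p v) * emeasure (K (c v)) (accepted (c v') v')"
  have err: "ennreal (p v * measure (K (c v)) {y \<in> space T. \<psi> y \<noteq> v}) \<le>
      ennreal (p v) * emeasure (K (c v)) (space T - accepted (c v) v) + (\<integral>\<^sup>+ v'. ?q v v' \<partial>count_space B)"
    if v: "v \<in> B" for v
  proof -
    interpret Kv: prob_space "K (c v)" using prob_space_K[OF cS[OF v]] .
    note sK[measurable_cong] = sets_K[OF cS[OF v]] and spK = space_K[OF cS[OF v]]
    let ?R = "space T - accepted (c v) v"
    let ?A = "\<lambda>v'. if v = v' then {} else accepted (c v') v'"
    have A: "?A v' \<in> sets T" if "v' \<in> B" for v'
      using accepted_sets[OF cS[OF that]] by simp
    have R: "?R \<in> sets T"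
      using accepted_sets[OF cS[OF v]] by auto
    have U: "(\<Union>v'\<in>B. ?A v') \<in> sets T"
      by (rule sets.countable_UN'[OF countable_B]) (use A in blast)
    have "ennreal (measure (K (c v)) {y \<in> space T. \<psi> y \<noteq> v}) = emeasure (K (c v)) {y \<in> space T. \<psi> y \<noteq> v}"
      by (rule Kv.emeasure_eq_measure[symmetric])
    also have "\<dots> \<le> emeasure (K (c v)) (?R \<union> (\<Union>v'\<in>B. ?A v'))"
    proof (rule emeasure_mono)
      show "{y \<in> space T. \<psi> y \<noteq> v} \<subseteq> ?R \<union> (\<Union>v'\<in>B. ?A v')"
      proof
        fix y assume "y \<in> {y \<in> space T. \<psi> y \<noteq> v}"
        then have y: "y \<in> space T" "\<psi> y \<noteq> v" by auto
        show "y \<in> ?R \<union> (\<Union>v'\<in>B. ?A v')"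
        proof (rule ccontr)
          assume n: "y \<notin> ?R \<union> (\<Union>v'\<in>B. ?A v')"
          then have "\<psi> y = v"
            using y(1) by (intro dec[OF v]) auto
          with y(2) show False ..
        qed
      qed
    qed (use R U sK in auto)
    also have "\<dots> \<le> emeasure (K (c v)) ?R + emeasure (K (c v)) (\<Union>v'\<in>B. ?A v')"
      using R U sK by (intro emeasure_subadditive) auto
    also have "emeasure (K (c v)) (\<Union>v'\<in>B. ?A v') \<le> (\<integral>\<^sup>+ v'. emeasure (K (c v)) (?A v') \<partial>count_space B)"
      using A sK by (intro emeasure_UN_le_nn_integral countable_B) auto
    finally have "ennreal (measure (K (c v)) {y \<in> space T. \<psi> y \<noteq> v}) \<le>
      emeasure (K (c v)) ?R + (\<integral>\<^sup>+ v'. emeasure (K (c v)) (?A v') \<partial>count_space B)"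
      by (simp add: add_left_mono)
    then have "ennreal (p v) * ennreal (measure (K (c v)) {y \<in> space T. \<psi> y \<noteq> v}) \<le>
      ennreal (p v) * (emeasure (K (c v)) ?R + (\<integral>\<^sup>+ v'. emeasure (K (c v)) (?A v') \<partial>count_space B))"
      by (rule mult_left_mono) simp
    also have "\<dots> = ennreal (p v) * emeasure (K (c v)) ?R +
        (\<integral>\<^sup>+ v'. ennreal (p v) * emeasure (K (c v)) (?A v') \<partial>count_space B)"
      by (simp add: distrib_left nn_integral_cmult)
    also have "(\<integral>\<^sup>+ v'. ennreal (p v) * emeasure (K (c v)) (?A v') \<partial>count_space B) = (\<integral>\<^sup>+ v'. ?q v v' \<partial>count_space B)"
      by (intro nn_integral_cong) auto
    finally show ?thesis
      by (simp add: ennreal_mult')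
  qed
  have "(\<integral>\<^sup>+ v. ennreal (p v * measure (K (c v)) {y \<in> space T. \<psi> y \<noteq> v}) \<partial>count_space B) \<le>
    (\<integral>\<^sup>+ v. ennreal (p v) * emeasure (K (c v)) (space T - accepted (c v) v) + (\<integral>\<^sup>+ v'. ?q v v' \<partial>count_space B) \<partial>count_space B)"
    by (intro nn_integral_mono err) simp
  also have "\<dots> = (\<integral>\<^sup>+ v. ennreal (p v) * emeasure (K (c v)) (space T - accepted (c v) v) \<partial>count_space B) +
     (\<integral>\<^sup>+ v. (\<integral>\<^sup>+ v'. ?q v v' \<partial>count_space B) \<partial>count_space B)"
    by (rule nn_integral_add) auto
  also have "(\<integral>\<^sup>+ v. (\<integral>\<^sup>+ v'. ?q v v' \<partial>count_space B) \<partial>count_space B) =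
      (\<integral>\<^sup>+ v'. (\<integral>\<^sup>+ v. ?q v v' \<partial>count_space B) \<partial>count_space B)"
    by (rule nn_integral_count_space_nn_integral[OF countable_B]) simp
  also have "(\<integral>\<^sup>+ v. ennreal (p v) * emeasure (K (c v)) (space T - accepted (c v) v) \<partial>count_space B) + \<dots> = error_bound c"
    by (simp add: error_bound_def)
  finally have "(\<integral>\<^sup>+ v. ennreal (p v * measure (K (c v)) {y \<in> space T. \<psi> y \<noteq> v}) \<partial>count_space B) \<le> ennreal ?b"
    using le by (rule order_trans)
  then have "(\<Sum>\<^sub>\<infinity>v\<in>B. p v * measure (K (c v)) {y \<in> space T. \<psi> y \<noteq> v}) \<le> ?b"
    using a_pos by (intro infsum_le_if_nn_integral_le) auto
  with cS \<psi> show ?thesis by (intro that[of c \<psi>]) auto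
qed

end

section \<open>Block codes\<close>

lemma source_law_prob:
  assumes V: "V n \<in> \<Omega> n \<rightarrow>\<^sub>M source_space A n" and v: "v \<in> source_blocks A n"
  shows "measure (source_law A \<Omega> V n) {v} = measure (\<Omega> n) {\<omega> \<in> space (\<Omega> n). V n \<omega> = v}"
  unfolding source_law_def using v
  by (subst measure_distr[OF V]) (auto intro!: arg_cong[where f="measure (\<Omega> n)"])

text \<open>
  The bound at a fixed block length with margin \<open>exp (n \<gamma>)\<close>. Since \<open>g(X, Y)\<close> and the probability of \<open>V\<close>
  are almost surely positive, taking logarithms in \<open>g(X, Y) P\<^sub>V(V) \<le> exp (n \<gamma>)\<close> gives the event of the
  hypothesis of the coding theorem.
\<close>

lemma one_shot_transmission:
  fixes A :: "'v set" and MX :: "'x measure" and MY :: "'y measure"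
    and \<Omega> :: "nat \<Rightarrow> 'w measure"
    and V :: "nat \<Rightarrow> 'w \<Rightarrow> nat \<Rightarrow> 'v"
    and X :: "nat \<Rightarrow> 'w \<Rightarrow> nat \<Rightarrow> 'x"
    and Y :: "nat \<Rightarrow> 'w \<Rightarrow> nat \<Rightarrow> 'y"
    and W :: "nat \<Rightarrow> (nat \<Rightarrow> 'x) \<Rightarrow> (nat \<Rightarrow> 'y) measure"
    and g :: "(nat \<Rightarrow> 'x) \<times> (nat \<Rightarrow> 'y) \<Rightarrow> real"
  assumes source_seq: "general_source A \<Omega> V"
    and channel_seq: "general_channel MX MY W"
    and input_seq: "channel_input \<Omega> MX X"
    and output_seq: "channel_output A MX MY \<Omega> W V X Y"
    and n: "n \<ge> 1"
    and ratio: "is_channel_ratio (\<Omega> n) (block_space MX n) (block_space MY n) (X n) (Y n) g"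
  shows "\<exists>\<phi> \<psi>. is_code A MX MY n \<phi> \<psi> \<and>
    error_prob A MY n (source_law A \<Omega> V n) (W n) \<phi> \<psi> \<le>
      measure (\<Omega> n) {\<omega> \<in> space (\<Omega> n). 1 / real n * ln (g (X n \<omega>, Y n \<omega>))
          \<le> 1 / real n * ln (1 / measure (source_law A \<Omega> V n) {V n \<omega>}) + \<gamma>} + exp (- (real n * \<gamma>))"
proof -
  let ?B = "source_blocks A n"
  let ?a = "exp (real n * \<gamma>)"
  have B: "countable ?B"
    using source_seq by (intro countable_PiE) (auto simp: general_source_def)
  have M: "prob_space (\<Omega> n)" and V: "V n \<in> \<Omega> n \<rightarrow>\<^sub>M source_space A n"
    using source_seq n by (auto simp: general_source_def)
  interpret prob_space "\<Omega> n" by fact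
  interpret rc: random_coding "\<Omega> n" ?B "block_space MX n" "block_space MY n" "V n" "X n" "Y n" "W n" g ?a
    using B V channel_seq input_seq output_seq n ratio
    by unfold_locales (auto simp: general_channel_def channel_input_def channel_output_def)
  note [measurable] = rc.V rc.X rc.Y rc.g_measurable
  have p: "measure (source_law A \<Omega> V n) {v} = rc.p v" if "v \<in> ?B" for v
    unfolding rc.p_def by (rule source_law_prob[where \<Omega>=\<Omega> and V=V and n=n and A=A, OF V that])
  obtain \<phi> \<psi> where \<phi>: "\<phi> \<in> ?B \<rightarrow> space (block_space MX n)" and \<psi>: "\<psi> \<in> block_space MY n \<rightarrow>\<^sub>M source_space A n"
    and err: "(\<Sum>\<^sub>\<infinity>v\<in>?B. rc.p v * measure (W n (\<phi> v)) {y \<in> space (block_space MY n). \<psi> y \<noteq> v}) \<le>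
      prob {\<omega> \<in> space (\<Omega> n). g (X n \<omega>, Y n \<omega>) * rc.p (V n \<omega>) \<le> ?a} + 1 / ?a"
    by (rule rc.exists_code)
  let ?E = "{\<omega> \<in> space (\<Omega> n). 1 / real n * ln (g (X n \<omega>, Y n \<omega>))
          \<le> 1 / real n * ln (1 / measure (source_law A \<Omega> V n) {V n \<omega>}) + \<gamma>}"
  have "(\<lambda>\<omega>. ln (1 / measure (source_law A \<Omega> V n) {V n \<omega>})) \<in> borel_measurable (\<Omega> n)"
    by (rule measurable_compose[OF V]) simp
  then have E: "?E \<in> events" by measurable
  have le: "AE \<omega> in \<Omega> n. \<omega> \<in> {\<omega> \<in> space (\<Omega> n). g (X n \<omega>, Y n \<omega>) * rc.p (V n \<omega>) \<le> ?a} \<longrightarrow> \<omega> \<in> ?E"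
    using channel_ratio_pos[OF rc.X rc.Y ratio] rc.AE_p_pos
  proof eventually_elim
    case (elim \<omega>)
    let ?g = "g (X n \<omega>, Y n \<omega>)" and ?p = "rc.p (V n \<omega>)"
    show ?case
    proof
      assume "\<omega> \<in> {\<omega> \<in> space (\<Omega> n). g (X n \<omega>, Y n \<omega>) * rc.p (V n \<omega>) \<le> ?a}"
      then have w: "\<omega> \<in> space (\<Omega> n)" and "?g * ?p \<le> ?a" by auto
      then have "ln (?g * ?p) \<le> real n * \<gamma>"
        using elim ln_mono[of "?g * ?p" ?a] by simp
      then have "ln ?g \<le> ln (1 / ?p) + real n * \<gamma>"
        using elim by (simp add: ln_mult ln_div)
      then have "1 / real n * ln ?g \<le> 1 / real n * (ln (1 / ?p) + real n * \<gamma>)"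
        by (rule mult_left_mono) simp
      then have "1 / real n * ln ?g \<le> 1 / real n * ln (1 / ?p) + \<gamma>"
        using n by (simp add: distrib_left)
      then show "\<omega> \<in> ?E"
        using w p[of "V n \<omega>"] measurable_space[OF V w] by simp
    qed
  qed
  have "error_prob A MY n (source_law A \<Omega> V n) (W n) \<phi> \<psi> =
    (\<Sum>\<^sub>\<infinity>v\<in>?B. rc.p v * measure (W n (\<phi> v)) {y \<in> space (block_space MY n). \<psi> y \<noteq> v})"
    unfolding error_prob_def by (intro infsum_cong) (simp add: p)
  also note err
  also have "prob {\<omega> \<in> space (\<Omega> n). g (X n \<omega>, Y n \<omega>) * rc.p (V n \<omega>) \<le> ?a} \<le> prob ?E"
    by (rule finite_measure_mono_AE[OF le E])
  finally have "error_prob A MY n (source_law A \<Omega> V n) (W n) \<phi> \<psi> \<le> prob ?E + exp (- (real n * \<gamma>))"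
    by (simp add: exp_minus divide_inverse)
  moreover have "is_code A MX MY n \<phi> \<psi>"
    using \<phi> \<psi> by (simp add: is_code_def)
  ultimately show ?thesis by blast
qed

theorem theorem4p1:
  fixes A :: "'v set" and MX :: "'x measure" and MY :: "'y measure"
    and \<Omega> :: "nat \<Rightarrow> 'w measure"
    and V :: "nat \<Rightarrow> 'w \<Rightarrow> nat \<Rightarrow> 'v"
    and X :: "nat \<Rightarrow> 'w \<Rightarrow> nat \<Rightarrow> 'x"
    and Y :: "nat \<Rightarrow> 'w \<Rightarrow> nat \<Rightarrow> 'y"
    and W :: "nat \<Rightarrow> (nat \<Rightarrow> 'x) \<Rightarrow> (nat \<Rightarrow> 'y) measure"
    and g :: "nat \<Rightarrow> (nat \<Rightarrow> 'x) \<times> (nat \<Rightarrow> 'y) \<Rightarrow> real"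
    and \<gamma> :: "nat \<Rightarrow> real"
  assumes source_seq: "general_source A \<Omega> V"
    and channel_seq: "general_channel MX MY W"
    and input_seq: "channel_input \<Omega> MX X"
    and output_seq: "channel_output A MX MY \<Omega> W V X Y"
    and ratio_seq: "\<And>n. n \<ge> 1 \<Longrightarrow>
      is_channel_ratio (\<Omega> n) (block_space MX n) (block_space MY n) (X n) (Y n) (g n)"
    and gamma_pos: "\<And>n. n \<ge> 1 \<Longrightarrow> \<gamma> n > 0"
    and gamma_lim: "\<gamma> \<longlonglongrightarrow> 0"
    and n_gamma_lim: "filterlim (\<lambda>n. real n * \<gamma> n) at_top sequentially"
    and prob_lim: "(\<lambda>n. measure (\<Omega> n) {\<omega> \<in> space (\<Omega> n).
        1 / real n * ln (g n (X n \<omega>, Y n \<omega>))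
          \<le> 1 / real n * ln (1 / measure (source_law A \<Omega> V n) {V n \<omega>}) + \<gamma> n}) \<longlonglongrightarrow> 0"
  shows "transmissible A MX MY (source_law A \<Omega> V) W"
proof -
  define E where "E n = measure (\<Omega> n) {\<omega> \<in> space (\<Omega> n).
        1 / real n * ln (g n (X n \<omega>, Y n \<omega>))
          \<le> 1 / real n * ln (1 / measure (source_law A \<Omega> V n) {V n \<omega>}) + \<gamma> n}" for n
  have "\<exists>\<phi> \<psi>. is_code A MX MY n \<phi> \<psi> \<and>
    error_prob A MY n (source_law A \<Omega> V n) (W n) \<phi> \<psi> \<le> E n + exp (- (real n * \<gamma> n))" if "n \<ge> 1" for n
    unfolding E_def
    by (rule one_shot_transmission[OF source_seq channel_seq input_seq output_seq that ratio_seq[OF that]])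
  then obtain \<phi> \<psi> where code: "\<And>n. n \<ge> 1 \<Longrightarrow> is_code A MX MY n (\<phi> n) (\<psi> n)"
    and err: "\<And>n. n \<ge> 1 \<Longrightarrow>
      error_prob A MY n (source_law A \<Omega> V n) (W n) (\<phi> n) (\<psi> n) \<le> E n + exp (- (real n * \<gamma> n))"
    by metis
  have "(\<lambda>n. exp (- (real n * \<gamma> n))) \<longlonglongrightarrow> 0"
    by (rule filterlim_compose[OF exp_at_bot]) (use n_gamma_lim in \<open>simp add: filterlim_uminus_at_bot\<close>)
  then have lim: "(\<lambda>n. E n + exp (- (real n * \<gamma> n))) \<longlonglongrightarrow> 0"
    using tendsto_add[OF prob_lim] by (simp add: E_def)
  have "(\<lambda>n. error_prob A MY n (source_law A \<Omega> V n) (W n) (\<phi> n) (\<psi> n)) \<longlonglongrightarrow> 0"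
  proof (rule tendsto_sandwich[OF _ _ tendsto_const lim])
    show "\<forall>\<^sub>F n in sequentially. 0 \<le> error_prob A MY n (source_law A \<Omega> V n) (W n) (\<phi> n) (\<psi> n)"
      unfolding error_prob_def
      by (rule always_eventually, rule allI, rule infsum_nonneg) simp
    show "\<forall>\<^sub>F n in sequentially.
        error_prob A MY n (source_law A \<Omega> V n) (W n) (\<phi> n) (\<psi> n) \<le> E n + exp (- (real n * \<gamma> n))"
      using err unfolding eventually_sequentially by blast
  qed
  with code show ?thesis
    unfolding transmissible_def by blast
qed

end
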